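(* For torsion theories $(\mathcal{S},\mathcal{G})\leq(\mathcal{T},\mathcal{F})$ in the lattice $\mu(Grp)$ consider the pretorsion theory $(\mathcal{T},\mathcal{G})$ in $Simp(Grp)$, with category of trivial objects $\mathcal{Z}=\mathcal{T}\cap\mathcal{G}$. Then: (1) in the case of $\mu_{n\geq}\leq\mu_{\geq n}$ ($n\ge 1$), every $\mathcal{Z}$-trivial simplicial group $X$ (i.e. every object $X$ of $\mathcal{Z}$) is isomorphic to the Eilenberg–Mac Lane simplicial group $K(\pi_n(X),n)$; (2) in the case of $\mu_{\geq n+1}\leq\mu_{n\geq}$ ($n\geq0$), every $\mathcal{Z}$-trivial simplicial group $X$ satisfies $\pi_k(X)=0$ for all $k$ (i.e. it is an aspherical simplicial group).
   Context: The Moore complex of a simplicial group $X$ has $N(X)_0=X_0$, $N(X)_n=\bigcap_{i=0}^{n-1}\ker(d_i:X_n\to X_{n-1})$, with differential the restriction of $d_n$; $\pi_n(X)\cong H_n(N(X))$. $\mathcal{M}_{n\geq}$ (resp. $\mathcal{M}_{\geq n}$) is the full subcategory of $Simp(Grp)$ of $X$ with $N(X)_i=0$ for $i>n$ (resp. $i<n$). $Cot_n:Simp(Grp)\to\mathcal{M}_{n\geq}$ is the left adjoint of the inclusion and $Ker(Cot_n)$ is the full subcategory of $X$ with $Cot_n(X)=0$. $tr_n$ is truncation, with right adjoint $cosk_n$, and $\mathcal{F}_{tr_n}$ is the full subcategory of $X$ for which the unit $X\to cosk_n tr_n(X)$ is monic. The torsion theories $\mu_{n\geq}=(Ker(Cot_n),\mathcal{M}_{n\geq})$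 ($n\geq0$) and $\mu_{\geq n}=(\mathcal{M}_{\geq n},\mathcal{F}_{tr_{n-1}})$ ($n\geq1$), together with the trivial ones, form the linearly ordered lattice $\mu(Grp)$ in $Simp(Grp)$, ordered by inclusion of torsion categories (first components), with $\mu_{\geq n+1}\leq\mu_{n\geq}\leq\mu_{\geq n}$. Thus in (1) $\mathcal{Z}=\mathcal{M}_{\geq n}\cap\mathcal{M}_{n\geq}$ and in (2) $\mathcal{Z}=Ker(Cot_n)\cap\mathcal{F}_{tr_n}$. A pair $(\mathbb{T},\mathbb{F})$ of full subcategories of a category is a pretorsion theory with class of trivial objects $\mathcal{Z}=\mathbb{T}\cap\mathbb{F}$ if every morphism from an object of $\mathbb{T}$ to an object of $\mathbb{F}$ factors through an object of $\mathcal{Z}$, and each object $X$ has a sequence $T_X\to X\to F_X$ with $T_X\in\mathbb{T}$, $F_X\in\mathbb{F}$ in which the first map is a prekernel of the second and the second a precokernel of the first, relative to the ideal of morphisms factoring through $\mathcal{Z}$. For torsion theories $(\mathcal{S},\mathcal{G})\leq(\mathcal{T},\mathcal{F})$ the pair $(\mathcal{T},\mathcal{G})$ is a pretorsion theory. For an abelian group $A$, $K(A,n)$ denotes the Eilenberg–Mac Lane simplicial group: the simplicial abelian group corresponding under Dold–Kan to $A$ concentrated in degree $n$. *)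

theory Defs
  imports "HOL-Algebra.Product_Groups" "HOL-Algebra.FiniteProduct" "HOL-Library.Extended_Nat"
begin

section \<open>Simplicial groups and their truncations\<close>

text \<open>
  A simplicial group is a functor from the opposite of the simplex category to groups. The ordinal
  \<open>[n]\<close> is \<open>{..n}\<close>, and a monotone map \<open>[m] \<rightarrow> [n]\<close> is represented by its extensional version, so
  that composition is \<^term>\<open>compose {..m}\<close>.
\<close>

definition simplex_maps :: "nat \<Rightarrow> nat \<Rightarrow> (nat \<Rightarrow> nat) set" where
  "simplex_maps m n = {\<theta> \<in> {..m} \<rightarrow>\<^sub>E {..n}. mono_on {..m} \<theta>}"

text \<open>\<open>coface n i\<close> is the injection \<open>[n] \<rightarrow> [n + 1]\<close> that misses \<open>i\<close>.\<close>

definition coface :: "nat \<Rightarrow> nat \<Rightarrow> nat \<Rightarrow> nat" where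
  "coface n i = (\<lambda>j\<in>{..n}. if j < i then j else Suc j)"

text \<open>For \<open>\<theta> : [m] \<rightarrow> [n]\<close>, the operator \<open>Act X m n \<theta>\<close> goes from level \<open>n\<close> to level \<open>m\<close>.\<close>

record 'a sgrp =
  Ob :: "nat \<Rightarrow> 'a monoid"
  Act :: "nat \<Rightarrow> nat \<Rightarrow> (nat \<Rightarrow> nat) \<Rightarrow> 'a \<Rightarrow> 'a"

text \<open>
  Only the levels up to \<open>N\<close> matter; \<open>N = \<infinity>\<close> gives simplicial groups, and \<open>N = n\<close> gives \<open>n\<close>-truncated
  ones.
\<close>

locale truncated_simplicial_group =
  fixes N :: enat and X :: "'a sgrp"
  assumes group_Ob: "enat n \<le> N \<Longrightarrow> group (Ob X n)"
    and Act_hom: "\<lbrakk>enat m \<le> N; enat n \<le> N; \<theta> \<in> simplex_maps m n\<rbrakk>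
      \<Longrightarrow> Act X m n \<theta> \<in> hom (Ob X n) (Ob X m)"
    and Act_id: "\<lbrakk>enat n \<le> N; x \<in> carrier (Ob X n)\<rbrakk> \<Longrightarrow> Act X n n (\<lambda>i\<in>{..n}. i) x = x"
    and Act_comp: "\<lbrakk>enat p \<le> N; enat m \<le> N; enat n \<le> N;
        \<phi> \<in> simplex_maps p m; \<theta> \<in> simplex_maps m n; x \<in> carrier (Ob X n)\<rbrakk>
      \<Longrightarrow> Act X p n (compose {..p} \<theta> \<phi>) x = Act X p m \<phi> (Act X m n \<theta> x)"

abbreviation simplicial_group :: "'a sgrp \<Rightarrow> bool" where
  "simplicial_group \<equiv> truncated_simplicial_group \<infinity>"

definition truncated_hom :: "enat \<Rightarrow> 'a sgrp \<Rightarrow> 'b sgrp \<Rightarrow> (nat \<Rightarrow> 'a \<Rightarrow> 'b) set" where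
  "truncated_hom N X Y = {f.
     (\<forall>n. enat n \<le> N \<longrightarrow> f n \<in> hom (Ob X n) (Ob Y n)) \<and>
     (\<forall>m n \<theta> x. enat m \<le> N \<and> enat n \<le> N \<and> \<theta> \<in> simplex_maps m n \<and> x \<in> carrier (Ob X n) \<longrightarrow>
        f m (Act X m n \<theta> x) = Act Y m n \<theta> (f n x))}"

abbreviation simplicial_hom :: "'a sgrp \<Rightarrow> 'b sgrp \<Rightarrow> (nat \<Rightarrow> 'a \<Rightarrow> 'b) set" where
  "simplicial_hom \<equiv> truncated_hom \<infinity>"

definition simplicial_isomorphic :: "'a sgrp \<Rightarrow> 'b sgrp \<Rightarrow> bool" where
  "simplicial_isomorphic X Y \<longleftrightarrow> (\<exists>f\<in>simplicial_hom X Y. \<forall>n. f n \<in> iso (Ob X n) (Ob Y n))"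

definition zero_sgrp :: "'a sgrp \<Rightarrow> bool" where
  "zero_sgrp X \<longleftrightarrow> (\<forall>n. trivial_group (Ob X n))"

text \<open>
  Morphisms are compared on carriers only. It is enough to test against objects with the same element
  type as the source, since the kernel is one of them (see \<open>monic_iff\<close> below).
\<close>

definition monic :: "'a sgrp \<Rightarrow> 'b sgrp \<Rightarrow> (nat \<Rightarrow> 'a \<Rightarrow> 'b) \<Rightarrow> bool" where
  "monic X Y f \<longleftrightarrow> f \<in> simplicial_hom X Y \<and>
     (\<forall>W :: 'a sgrp. \<forall>g h. simplicial_group W \<and> g \<in> simplicial_hom W X \<and> h \<in> simplicial_hom W X \<and>
        (\<forall>n. \<forall>w\<in>carrier (Ob W n). f n (g n w) = f n (h n w)) \<longrightarrow>
        (\<forall>n. \<forall>w\<in>carrier (Ob W n). g n w = h n w))"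

lemma simplex_maps_id [simp]: "(\<lambda>i\<in>{..n}. i) \<in> simplex_maps n n"
  by (auto simp: simplex_maps_def mono_on_def)

lemma simplex_maps_compose [simp]:
  assumes "\<phi> \<in> simplex_maps p m" "\<theta> \<in> simplex_maps m n"
  shows "compose {..p} \<theta> \<phi> \<in> simplex_maps p n"
proof -
  have f: "\<And>i. i \<le> p \<Longrightarrow> \<phi> i \<le> m" "\<And>i. i \<le> m \<Longrightarrow> \<theta> i \<le> n"
    using assms by (auto simp: simplex_maps_def PiE_iff)
  show ?thesis using assms f
    by (fastforce simp: simplex_maps_def compose_def mono_on_def PiE_iff)
qed

lemma simplex_maps_le: "\<lbrakk>\<theta> \<in> simplex_maps m n; i \<le> m\<rbrakk> \<Longrightarrow> \<theta> i \<le> n"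
  by (auto simp: simplex_maps_def PiE_iff)

lemma simplex_maps_compose_id:
  "\<theta> \<in> simplex_maps m n \<Longrightarrow> compose {..m} \<theta> (\<lambda>i\<in>{..m}. i) = \<theta>"
  "\<theta> \<in> simplex_maps m n \<Longrightarrow> compose {..m} (\<lambda>i\<in>{..n}. i) \<theta> = \<theta>"
  by (auto simp: simplex_maps_def compose_def PiE_def extensional_def fun_eq_iff)

lemma simplex_maps_compose_assoc:
  assumes "\<phi> \<in> simplex_maps p m"
  shows "compose {..p} (compose {..m} \<eta> \<theta>) \<phi> = compose {..p} \<eta> (compose {..p} \<theta> \<phi>)"
  using assms by (auto simp: compose_def fun_eq_iff simplex_maps_le)

lemma coface_simplex_maps [simp]: "coface n i \<in> simplex_maps n (Suc n)"
  by (auto simp: coface_def simplex_maps_def mono_on_def)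

lemma face_coface: "0 < n \<Longrightarrow> coface (n - 1) i \<in> simplex_maps (n - 1) n"
  using coface_simplex_maps[of "n - 1" i] by simp

lemma simplicial_homD:
  assumes "f \<in> simplicial_hom X Y"
  shows "f n \<in> hom (Ob X n) (Ob Y n)"
    and "\<lbrakk>\<theta> \<in> simplex_maps m n; x \<in> carrier (Ob X n)\<rbrakk>
      \<Longrightarrow> f m (Act X m n \<theta> x) = Act Y m n \<theta> (f n x)"
    and "x \<in> carrier (Ob X n) \<Longrightarrow> f n x \<in> carrier (Ob Y n)"
  using assms by (auto simp: truncated_hom_def hom_def Pi_iff)

lemma simplicial_groupD:
  assumes "simplicial_group X"
  shows "group (Ob X n)"
    and "\<theta> \<in> simplex_maps m n \<Longrightarrow> Act X m n \<theta> \<in> hom (Ob X n) (Ob X m)"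
    and "\<lbrakk>\<theta> \<in> simplex_maps m n; x \<in> carrier (Ob X n)\<rbrakk> \<Longrightarrow> Act X m n \<theta> x \<in> carrier (Ob X m)"
    and "x \<in> carrier (Ob X n) \<Longrightarrow> Act X n n (\<lambda>i\<in>{..n}. i) x = x"
    and "\<lbrakk>\<phi> \<in> simplex_maps p m; \<theta> \<in> simplex_maps m n; x \<in> carrier (Ob X n)\<rbrakk>
      \<Longrightarrow> Act X p n (compose {..p} \<theta> \<phi>) x = Act X p m \<phi> (Act X m n \<theta> x)"
proof -
  interpret truncated_simplicial_group \<infinity> X by fact
  show "group (Ob X n)" "\<theta> \<in> simplex_maps m n \<Longrightarrow> Act X m n \<theta> \<in> hom (Ob X n) (Ob X m)"
    "x \<in> carrier (Ob X n) \<Longrightarrow> Act X n n (\<lambda>i\<in>{..n}. i) x = x"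
    "\<lbrakk>\<phi> \<in> simplex_maps p m; \<theta> \<in> simplex_maps m n; x \<in> carrier (Ob X n)\<rbrakk>
      \<Longrightarrow> Act X p n (compose {..p} \<theta> \<phi>) x = Act X p m \<phi> (Act X m n \<theta> x)"
    by (simp_all add: group_Ob Act_hom Act_id Act_comp)
  show "\<lbrakk>\<theta> \<in> simplex_maps m n; x \<in> carrier (Ob X n)\<rbrakk> \<Longrightarrow> Act X m n \<theta> x \<in> carrier (Ob X m)"
    using Act_hom[of m n \<theta>] by (auto simp: hom_def Pi_iff)
qed

lemma simplicial_groupI:
  assumes "\<And>n. group (Ob X n)"
    and "\<And>m n \<theta>. \<theta> \<in> simplex_maps m n \<Longrightarrow> Act X m n \<theta> \<in> hom (Ob X n) (Ob X m)"
    and "\<And>n x. x \<in> carrier (Ob X n) \<Longrightarrow> Act X n n (\<lambda>i\<in>{..n}. i) x = x"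
    and "\<And>p m n \<phi> \<theta> x. \<lbrakk>\<phi> \<in> simplex_maps p m; \<theta> \<in> simplex_maps m n; x \<in> carrier (Ob X n)\<rbrakk>
      \<Longrightarrow> Act X p n (compose {..p} \<theta> \<phi>) x = Act X p m \<phi> (Act X m n \<theta> x)"
  shows "simplicial_group X"
  by (rule truncated_simplicial_group.intro) (use assms in blast)+

lemma simplicial_homI:
  assumes "\<And>n. f n \<in> hom (Ob X n) (Ob Y n)"
    and "\<And>m n \<theta> x. \<lbrakk>\<theta> \<in> simplex_maps m n; x \<in> carrier (Ob X n)\<rbrakk>
      \<Longrightarrow> f m (Act X m n \<theta> x) = Act Y m n \<theta> (f n x)"
  shows "f \<in> simplicial_hom X Y"
  using assms by (auto simp: truncated_hom_def)

lemma simplicial_hom_group_hom: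
  assumes "simplicial_group X" "simplicial_group Y" "f \<in> simplicial_hom X Y"
  shows "group_hom (Ob X n) (Ob Y n) (f n)"
  using assms by (auto intro!: group_hom.intro group_hom_axioms.intro simplicial_groupD simplicial_homD)

lemma Act_group_hom:
  assumes "simplicial_group X" "\<theta> \<in> simplex_maps m n"
  shows "group_hom (Ob X n) (Ob X m) (Act X m n \<theta>)"
  using assms by (auto intro!: group_hom.intro group_hom_axioms.intro simplicial_groupD)

lemma monic_iff:
  fixes X :: "'a sgrp" and Y :: "'b sgrp"
  assumes X: "simplicial_group X" and Y: "simplicial_group Y"
  shows "monic X Y f \<longleftrightarrow> f \<in> simplicial_hom X Y \<and> (\<forall>n. inj_on (f n) (carrier (Ob X n)))"
proof
  assume m: "monic X Y f"
  then have f: "f \<in> simplicial_hom X Y" by (simp add: monic_def)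
  define W where "W = \<lparr>Ob = (\<lambda>n. (Ob X n)\<lparr>carrier := kernel (Ob X n) (Ob Y n) (f n)\<rparr>), Act = Act X\<rparr>"
  have sub: "subgroup (kernel (Ob X n) (Ob Y n) (f n)) (Ob X n)" for n
    by (rule group_hom.subgroup_kernel[OF simplicial_hom_group_hom[OF X Y f]])
  have Ker: "Act X m n \<theta> x \<in> kernel (Ob X m) (Ob Y m) (f m)"
    if "\<theta> \<in> simplex_maps m n" "x \<in> kernel (Ob X n) (Ob Y n) (f n)" for m n \<theta> x
    using that simplicial_homD[OF f] simplicial_groupD(3)[OF X]
      group_hom.hom_one[OF Act_group_hom[OF Y that(1)]] by (auto simp: kernel_def)
  have KX: "kernel (Ob X n) (Ob Y n) (f n) \<subseteq> carrier (Ob X n)" for n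
    by (auto simp: kernel_def)
  have W: "simplicial_group W"
  proof (rule simplicial_groupI)
    show "group (Ob W n)" for n
      using subgroup.subgroup_is_group[OF sub simplicial_groupD(1)[OF X]] by (simp add: W_def)
    show "Act W m n \<theta> \<in> hom (Ob W n) (Ob W m)" if "\<theta> \<in> simplex_maps m n" for m n \<theta>
      using Ker[OF that] simplicial_groupD(2)[OF X that] KX
      by (auto simp: hom_def W_def Pi_iff subset_iff)
  qed (use KX in \<open>auto simp: W_def subset_iff simplicial_groupD[OF X]\<close>)
  have incl: "(\<lambda>n x. x) \<in> simplicial_hom W X"
    using KX by (intro simplicial_homI) (auto simp: W_def hom_def)
  have triv: "(\<lambda>n x. \<one>\<^bsub>Ob X n\<^esub>) \<in> simplicial_hom W X"
    by (intro simplicial_homI) (auto simp: W_def hom_def group.is_monoid simplicial_groupD[OF X]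
        group_hom.hom_one[OF Act_group_hom[OF X]] monoid.l_one monoid.one_closed)
  have eq: "f n w = f n \<one>\<^bsub>Ob X n\<^esub>" if "w \<in> carrier (Ob W n)" for n w
    using that group_hom.hom_one[OF simplicial_hom_group_hom[OF X Y f]] by (auto simp: W_def kernel_def)
  have "\<forall>n. \<forall>w\<in>carrier (Ob W n). w = \<one>\<^bsub>Ob X n\<^esub>"
    using m W incl triv eq unfolding monic_def by blast
  then have "kernel (Ob X n) (Ob Y n) (f n) = {\<one>\<^bsub>Ob X n\<^esub>}" for n
    using subgroup.one_closed[OF sub] by (auto simp: W_def)
  then show "f \<in> simplicial_hom X Y \<and> (\<forall>n. inj_on (f n) (carrier (Ob X n)))"
    using f group_hom.inj_iff_trivial_ker[OF simplicial_hom_group_hom[OF X Y f]] by blast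
next
  assume a: "f \<in> simplicial_hom X Y \<and> (\<forall>n. inj_on (f n) (carrier (Ob X n)))"
  show "monic X Y f"
    unfolding monic_def
  proof (intro conjI allI impI ballI)
    fix W :: "'a sgrp" and g h n w
    assume *: "simplicial_group W \<and> g \<in> simplicial_hom W X \<and> h \<in> simplicial_hom W X \<and>
      (\<forall>n. \<forall>w\<in>carrier (Ob W n). f n (g n w) = f n (h n w))" and w: "w \<in> carrier (Ob W n)"
    have "g n w \<in> carrier (Ob X n)" "h n w \<in> carrier (Ob X n)"
      using * w by (blast intro: simplicial_homD(3))+
    then show "g n w = h n w" using * w a by (meson inj_onD)
  qed (use a in simp)
qed

section \<open>Moore complex and homotopy groups\<close>

definition face :: "'a sgrp \<Rightarrow> nat \<Rightarrow> nat \<Rightarrow> 'a \<Rightarrow> 'a" where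
  "face X n i = Act X (n - 1) n (coface (n - 1) i)"

definition moore :: "'a sgrp \<Rightarrow> nat \<Rightarrow> 'a monoid" where
  "moore X n = (Ob X n)\<lparr>carrier :=
     carrier (Ob X n) \<inter> (\<Inter>i<n. kernel (Ob X n) (Ob X (n - 1)) (face X n i))\<rparr>"

definition moore_cycles :: "'a sgrp \<Rightarrow> nat \<Rightarrow> 'a set" where
  "moore_cycles X n =
     (if n = 0 then carrier (moore X 0) else kernel (moore X n) (moore X (n - 1)) (face X n n))"

definition moore_boundaries :: "'a sgrp \<Rightarrow> nat \<Rightarrow> 'a set" where
  "moore_boundaries X n = face X (Suc n) (Suc n) ` carrier (moore X (Suc n))"

definition homotopy_group :: "'a sgrp \<Rightarrow> nat \<Rightarrow> 'a set monoid" where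
  "homotopy_group X n = (moore X n)\<lparr>carrier := moore_cycles X n\<rparr> Mod moore_boundaries X n"

lemma face_closed:
  assumes "simplicial_group X" "0 < n" "x \<in> carrier (Ob X n)"
  shows "face X n i x \<in> carrier (Ob X (n - 1))"
  using assms simplicial_groupD(3)[OF assms(1) face_coface[OF assms(2)]] by (simp add: face_def)

lemma carrier_moore: "carrier (moore X n) = {x \<in> carrier (Ob X n). \<forall>i<n. face X n i x = \<one>\<^bsub>Ob X (n - 1)\<^esub>}"
  by (auto simp: moore_def kernel_def)

lemma group_moore:
  assumes X: "simplicial_group X"
  shows "group (moore X n)"
proof -
  have gh: "group_hom (Ob X n) (Ob X (n - 1)) (face X n i)" if "0 < n" for i
    using Act_group_hom[OF X face_coface[OF that]] by (simp add: face_def)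
  have "subgroup (carrier (moore X n)) (Ob X n)"
  proof (cases "n = 0")
    case True
    then show ?thesis
      using group.subgroup_self[OF simplicial_groupD(1)[OF X]] by (simp add: moore_def)
  next
    case False
    then show ?thesis using simplicial_groupD(1)[OF X]
      by (intro group.subgroupI)
        (auto simp: carrier_moore group_hom.hom_one[OF gh] group_hom.hom_mult[OF gh]
          group_hom.hom_inv[OF gh] monoid.l_one monoid.inv_one monoid.m_closed group.is_monoid intro: exI[of _ "\<one>\<^bsub>Ob X n\<^esub>"])
  qed
  then show ?thesis
    using subgroup.subgroup_is_group[OF _ simplicial_groupD(1)[OF X]] by (simp add: moore_def)
qed

lemma trivial_moore_iff:
  assumes X: "simplicial_group X"
  shows "trivial_group (moore X n) \<longleftrightarrow>
    (\<forall>x\<in>carrier (Ob X n). (\<forall>i<n. face X n i x = \<one>\<^bsub>Ob X (n - 1)\<^esub>) \<longrightarrow> x = \<one>\<^bsub>Ob X n\<^esub>)"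
proof -
  have "\<one>\<^bsub>Ob X n\<^esub> \<in> carrier (moore X n)" "\<one>\<^bsub>moore X n\<^esub> = \<one>\<^bsub>Ob X n\<^esub>"
    using group.is_monoid[OF group_moore[OF X], THEN monoid.one_closed] by (auto simp: moore_def)
  then show ?thesis
    unfolding trivial_group_def using group_moore[OF X] by (auto simp: carrier_moore)
qed

definition M_upto :: "nat \<Rightarrow> 'a sgrp set" where
  "M_upto n = {X. simplicial_group X \<and> (\<forall>i>n. trivial_group (moore X i))}"

definition M_from :: "nat \<Rightarrow> 'a sgrp set" where
  "M_from n = {X. simplicial_group X \<and> (\<forall>i<n. trivial_group (moore X i))}"

section \<open>The reflector onto \<open>M_upto n\<close>\<close>

definition normal_simplicial_subgroup :: "'a sgrp \<Rightarrow> (nat \<Rightarrow> 'a set) \<Rightarrow> bool" where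
  "normal_simplicial_subgroup X K \<longleftrightarrow> (\<forall>n. K n \<lhd> Ob X n) \<and>
     (\<forall>m n. \<forall>\<theta>\<in>simplex_maps m n. Act X m n \<theta> ` K n \<subseteq> K m)"

text \<open>The operators send the coset of \<open>x\<close> to the coset of its image.\<close>

definition quotient_sgrp :: "'a sgrp \<Rightarrow> (nat \<Rightarrow> 'a set) \<Rightarrow> 'a set sgrp" where
  "quotient_sgrp X K = \<lparr>Ob = (\<lambda>n. Ob X n Mod K n),
     Act = (\<lambda>m n \<theta> C. K m <#>\<^bsub>Ob X m\<^esub> (Act X m n \<theta> ` C))\<rparr>"

text \<open>
  The left adjoint of the inclusion of \<open>M_upto n\<close> sends \<open>X\<close> to its largest quotient in \<open>M_upto n\<close>; the
  universal property is proved below (\<open>Cot_in_M_upto\<close>, \<open>Cot_universal\<close>).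
\<close>

definition Cot_kernel :: "nat \<Rightarrow> 'a sgrp \<Rightarrow> nat \<Rightarrow> 'a set" where
  "Cot_kernel n X m =
     \<Inter>{K m |K. normal_simplicial_subgroup X K \<and> quotient_sgrp X K \<in> M_upto n}"

definition Cot :: "nat \<Rightarrow> 'a sgrp \<Rightarrow> 'a set sgrp" where
  "Cot n X = quotient_sgrp X (Cot_kernel n X)"

definition Cot_unit :: "nat \<Rightarrow> 'a sgrp \<Rightarrow> nat \<Rightarrow> 'a \<Rightarrow> 'a set" where
  "Cot_unit n X m x = Cot_kernel n X m #>\<^bsub>Ob X m\<^esub> x"

definition Ker_Cot :: "nat \<Rightarrow> 'a sgrp set" where
  "Ker_Cot n = {X. simplicial_group X \<and> zero_sgrp (Cot n X)}"

lemma quotient_Act: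
  assumes X: "simplicial_group X" and K: "normal_simplicial_subgroup X K"
    and \<theta>: "\<theta> \<in> simplex_maps m n" and x: "x \<in> carrier (Ob X n)"
  shows "Act (quotient_sgrp X K) m n \<theta> (K n #>\<^bsub>Ob X n\<^esub> x) = K m #>\<^bsub>Ob X m\<^esub> Act X m n \<theta> x"
proof -
  interpret h: group_hom "Ob X n" "Ob X m" "Act X m n \<theta>" by (rule Act_group_hom[OF X \<theta>])
  have Kn: "normal (K n) (Ob X n)" and Km: "normal (K m) (Ob X m)"
    and sub: "Act X m n \<theta> ` K n \<subseteq> K m"
    using K \<theta> by (auto simp: normal_simplicial_subgroup_def)
  interpret kn: normal "K n" "Ob X n" by fact
  interpret km: normal "K m" "Ob X m" by fact
  have y: "Act X m n \<theta> x \<in> carrier (Ob X m)" using x by simp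
  have im: "Act X m n \<theta> ` (K n #>\<^bsub>Ob X n\<^esub> x) = (\<lambda>k. Act X m n \<theta> k \<otimes>\<^bsub>Ob X m\<^esub> Act X m n \<theta> x) ` K n"
    using x by (auto simp: r_coset_def image_UN)
  show ?thesis
  proof
    show "Act (quotient_sgrp X K) m n \<theta> (K n #>\<^bsub>Ob X n\<^esub> x) \<subseteq> K m #>\<^bsub>Ob X m\<^esub> Act X m n \<theta> x"
    proof -
      have "a \<otimes>\<^bsub>Ob X m\<^esub> (Act X m n \<theta> k \<otimes>\<^bsub>Ob X m\<^esub> Act X m n \<theta> x) \<in> K m #>\<^bsub>Ob X m\<^esub> Act X m n \<theta> x"
        if "a \<in> K m" "k \<in> K n" for a k
      proof -
        have "Act X m n \<theta> k \<in> K m" using sub that by blast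
        then have "a \<otimes>\<^bsub>Ob X m\<^esub> (Act X m n \<theta> k \<otimes>\<^bsub>Ob X m\<^esub> Act X m n \<theta> x) =
            (a \<otimes>\<^bsub>Ob X m\<^esub> Act X m n \<theta> k) \<otimes>\<^bsub>Ob X m\<^esub> Act X m n \<theta> x"
          using that y by (simp add: h.H.m_assoc)
        moreover have "a \<otimes>\<^bsub>Ob X m\<^esub> Act X m n \<theta> k \<in> K m"
          using that \<open>Act X m n \<theta> k \<in> K m\<close> by simp
        ultimately show ?thesis by (auto simp: r_coset_def)
      qed
      then show ?thesis unfolding quotient_sgrp_def by (simp add: set_mult_def im del: UN_simps) blast
    qed
    show "K m #>\<^bsub>Ob X m\<^esub> Act X m n \<theta> x \<subseteq> Act (quotient_sgrp X K) m n \<theta> (K n #>\<^bsub>Ob X n\<^esub> x)"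
    proof
      fix z assume "z \<in> K m #>\<^bsub>Ob X m\<^esub> Act X m n \<theta> x"
      then obtain a where a: "a \<in> K m" "z = a \<otimes>\<^bsub>Ob X m\<^esub> Act X m n \<theta> x"
        by (auto simp: r_coset_def)
      have "x \<in> K n #>\<^bsub>Ob X n\<^esub> x" by (rule h.G.rcos_self[OF x kn.subgroup_axioms])
      then show "z \<in> Act (quotient_sgrp X K) m n \<theta> (K n #>\<^bsub>Ob X n\<^esub> x)"
        using a unfolding quotient_sgrp_def by (simp add: set_mult_def del: image_iff) blast
    qed
  qed
qed

lemma carrier_quotient: "carrier (Ob (quotient_sgrp X K) n) = (\<lambda>x. K n #>\<^bsub>Ob X n\<^esub> x) ` carrier (Ob X n)"
  by (simp add: quotient_sgrp_def carrier_FactGroup)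

lemma one_quotient: "\<one>\<^bsub>Ob (quotient_sgrp X K) n\<^esub> = K n"
  by (simp add: quotient_sgrp_def)

lemma rcos_eq_iff:
  assumes X: "simplicial_group X" and K: "normal_simplicial_subgroup X K" and x: "x \<in> carrier (Ob X n)"
  shows "K n #>\<^bsub>Ob X n\<^esub> x = K n \<longleftrightarrow> x \<in> K n"
proof -
  interpret normal "K n" "Ob X n" using K by (simp add: normal_simplicial_subgroup_def)
  show ?thesis using x by (metis coset_join1 coset_join2 subgroup_axioms)
qed

lemma quotient_unit_hom:
  assumes X: "simplicial_group X" and K: "normal_simplicial_subgroup X K"
  shows "(\<lambda>x. K n #>\<^bsub>Ob X n\<^esub> x) \<in> hom (Ob X n) (Ob (quotient_sgrp X K) n)"
proof -
  interpret normal "K n" "Ob X n" using K by (simp add: normal_simplicial_subgroup_def)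
  show ?thesis using r_coset_hom_Mod by (simp add: quotient_sgrp_def)
qed

lemma simplicial_group_quotient:
  assumes X: "simplicial_group X" and K: "normal_simplicial_subgroup X K"
  shows "simplicial_group (quotient_sgrp X K)"
proof (rule simplicial_groupI)
  fix n
  interpret normal "K n" "Ob X n" using K by (simp add: normal_simplicial_subgroup_def)
  show "group (Ob (quotient_sgrp X K) n)" using factorgroup_is_group by (simp add: quotient_sgrp_def)
next
  fix m n \<theta> assume \<theta>: "\<theta> \<in> simplex_maps m n"
  interpret h: group_hom "Ob X n" "Ob X m" "Act X m n \<theta>" by (rule Act_group_hom[OF X \<theta>])
  note hn = quotient_unit_hom[OF X K, of n] and hm = quotient_unit_hom[OF X K, of m]
  show "Act (quotient_sgrp X K) m n \<theta> \<in> hom (Ob (quotient_sgrp X K) n) (Ob (quotient_sgrp X K) m)"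
  proof (rule homI)
    fix C assume "C \<in> carrier (Ob (quotient_sgrp X K) n)"
    then show "Act (quotient_sgrp X K) m n \<theta> C \<in> carrier (Ob (quotient_sgrp X K) m)"
      by (auto simp: carrier_quotient quotient_Act[OF X K \<theta>])
  next
    fix C D assume "C \<in> carrier (Ob (quotient_sgrp X K) n)" "D \<in> carrier (Ob (quotient_sgrp X K) n)"
    then obtain x y where x: "x \<in> carrier (Ob X n)" "y \<in> carrier (Ob X n)"
      and CD: "C = K n #>\<^bsub>Ob X n\<^esub> x" "D = K n #>\<^bsub>Ob X n\<^esub> y" by (auto simp: carrier_quotient)
    then show "Act (quotient_sgrp X K) m n \<theta> (C \<otimes>\<^bsub>Ob (quotient_sgrp X K) n\<^esub> D) =
      Act (quotient_sgrp X K) m n \<theta> C \<otimes>\<^bsub>Ob (quotient_sgrp X K) m\<^esub> Act (quotient_sgrp X K) m n \<theta> D"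
      using hom_mult[OF hn, of x y] hom_mult[OF hm, of "Act X m n \<theta> x" "Act X m n \<theta> y"]
      by (simp add: quotient_Act[OF X K \<theta>] flip: hom_mult[OF hn])
  qed
qed (auto simp: carrier_quotient quotient_Act[OF X K] simplicial_groupD[OF X])

lemma quotient_in_M_upto_iff:
  assumes X: "simplicial_group X" and K: "normal_simplicial_subgroup X K"
  shows "quotient_sgrp X K \<in> M_upto n \<longleftrightarrow>
    (\<forall>i>n. \<forall>x\<in>carrier (Ob X i). (\<forall>j<i. face X i j x \<in> K (i - 1)) \<longrightarrow> x \<in> K i)"
proof -
  have f: "face (quotient_sgrp X K) i j (K i #>\<^bsub>Ob X i\<^esub> x) = K (i - 1) \<longleftrightarrow> face X i j x \<in> K (i - 1)"
    if "0 < i" "x \<in> carrier (Ob X i)" for i j x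
    using quotient_Act[OF X K face_coface[OF that(1)] that(2)]
      rcos_eq_iff[OF X K face_closed[OF X that]] by (simp add: face_def)
  have "trivial_group (moore (quotient_sgrp X K) i) \<longleftrightarrow>
      (\<forall>x\<in>carrier (Ob X i). (\<forall>j<i. face X i j x \<in> K (i - 1)) \<longrightarrow> x \<in> K i)" if "0 < i" for i
    unfolding trivial_moore_iff[OF simplicial_group_quotient[OF X K]]
    using that by (simp add: carrier_quotient one_quotient f[simplified] rcos_eq_iff[OF X K])
  then have "trivial_group (moore (quotient_sgrp X K) i) \<longleftrightarrow>
      (\<forall>x\<in>carrier (Ob X i). (\<forall>j<i. face X i j x \<in> K (i - 1)) \<longrightarrow> x \<in> K i)" if "n < i" for i
    using that by (metis gr_zeroI not_less0)
  then show ?thesis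
    unfolding M_upto_def using simplicial_group_quotient[OF X K] by blast
qed

lemma normal_simplicial_Cot_kernel:
  assumes X: "simplicial_group X"
  shows "normal_simplicial_subgroup X (Cot_kernel n X)"
proof -
  let ?\<K> = "{K. normal_simplicial_subgroup X K \<and> quotient_sgrp X K \<in> M_upto n}"
  let ?U = "\<lambda>m. carrier (Ob X m)"
  have U: "normal_simplicial_subgroup X ?U"
  proof -
    have "carrier (Ob X m) \<lhd> Ob X m" for m
    proof -
      interpret group "Ob X m" by (rule simplicial_groupD(1)[OF X])
      show ?thesis by (auto simp: normal_inv_iff subgroup_self)
    qed
    then show ?thesis by (auto simp: normal_simplicial_subgroup_def simplicial_groupD[OF X])
  qed
  have UK: "?U \<in> ?\<K>" using U quotient_in_M_upto_iff[OF X U] by auto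
  have eq: "Cot_kernel n X m = (\<Inter>K\<in>?\<K>. K m)" for m
    by (auto simp: Cot_kernel_def)
  have nK: "K m \<lhd> Ob X m" "\<theta> \<in> simplex_maps l m \<Longrightarrow> x \<in> K m \<Longrightarrow> Act X l m \<theta> x \<in> K l"
    if "K \<in> ?\<K>" for K l m \<theta> x
    using that unfolding normal_simplicial_subgroup_def by blast+
  have "Cot_kernel n X m \<lhd> Ob X m" for m
  proof -
    interpret group "Ob X m" by (rule simplicial_groupD(1)[OF X])
    have "subgroup (\<Inter>K\<in>?\<K>. K m) (Ob X m)"
    proof (rule subgroups_Inter)
      show "subgroup H (Ob X m)" if "H \<in> (\<lambda>K. K m) ` ?\<K>" for H
        using that nK(1) by (blast intro: normal_imp_subgroup)
    qed (use UK in blast)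
    moreover have "x \<otimes>\<^bsub>Ob X m\<^esub> h \<otimes>\<^bsub>Ob X m\<^esub> inv\<^bsub>Ob X m\<^esub> x \<in> K m"
      if "K \<in> ?\<K>" "x \<in> carrier (Ob X m)" "h \<in> K m" for K x h
      using nK(1)[OF that(1), of m] that(2,3) unfolding normal_inv_iff by blast
    ultimately show ?thesis unfolding normal_inv_iff eq by blast
  qed
  moreover have "Act X l m \<theta> ` Cot_kernel n X m \<subseteq> Cot_kernel n X l" if "\<theta> \<in> simplex_maps l m" for l m \<theta>
    using nK(2)[OF _ that] unfolding eq by blast
  ultimately show ?thesis by (simp add: normal_simplicial_subgroup_def)
qed

lemma Cot_in_M_upto:
  assumes X: "simplicial_group X"
  shows "Cot n X \<in> M_upto n"
  unfolding Cot_def quotient_in_M_upto_iff[OF X normal_simplicial_Cot_kernel[OF X]]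
proof (intro allI impI ballI)
  fix i x assume i: "n < i" and x: "x \<in> carrier (Ob X i)"
    and a: "\<forall>j<i. face X i j x \<in> Cot_kernel n X (i - 1)"
  show "x \<in> Cot_kernel n X i"
    unfolding Cot_kernel_def
  proof clarify
    fix K assume K: "normal_simplicial_subgroup X K" "quotient_sgrp X K \<in> M_upto n"
    have "\<forall>j<i. face X i j x \<in> K (i - 1)" using a K by (auto simp: Cot_kernel_def)
    then show "x \<in> K i" using K i x quotient_in_M_upto_iff[OF X K(1)] by blast
  qed
qed

lemma Cot_unit_hom:
  assumes X: "simplicial_group X"
  shows "Cot_unit n X \<in> simplicial_hom X (Cot n X)"
proof -
  note K = normal_simplicial_Cot_kernel[OF X, of n]
  have "Cot_unit n X = (\<lambda>m x. Cot_kernel n X m #>\<^bsub>Ob X m\<^esub> x)"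
    by (simp add: Cot_unit_def fun_eq_iff)
  then show ?thesis
    using quotient_unit_hom[OF X K] quotient_Act[OF X K]
    by (intro simplicial_homI) (simp_all add: Cot_def)
qed

lemma Cot_universal:
  fixes Y :: "'b sgrp"
  assumes X: "simplicial_group X" and Y: "Y \<in> M_upto n" and f: "f \<in> simplicial_hom X Y"
  shows "\<exists>g\<in>simplicial_hom (Cot n X) Y.
      (\<forall>m. \<forall>x\<in>carrier (Ob X m). g m (Cot_unit n X m x) = f m x) \<and>
      (\<forall>g'\<in>simplicial_hom (Cot n X) Y. (\<forall>m. \<forall>x\<in>carrier (Ob X m). g' m (Cot_unit n X m x) = f m x) \<longrightarrow>
         (\<forall>m. \<forall>c\<in>carrier (Ob (Cot n X) m). g' m c = g m c))"
proof -
  note K = normal_simplicial_Cot_kernel[OF X, of n]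
  have sY: "simplicial_group Y" using Y by (simp add: M_upto_def)
  note gh = simplicial_hom_group_hom[OF X sY f]
  let ?L = "\<lambda>m. kernel (Ob X m) (Ob Y m) (f m)"
  have L: "normal_simplicial_subgroup X ?L"
  proof -
    have "Act X l m \<theta> x \<in> ?L l" if "\<theta> \<in> simplex_maps l m" "x \<in> ?L m" for l m \<theta> x
      using that simplicial_homD[OF f] simplicial_groupD(3)[OF X]
        group_hom.hom_one[OF Act_group_hom[OF sY that(1)]] by (auto simp: kernel_def)
    then show ?thesis using group_hom.normal_kernel[OF gh]
      by (auto simp: normal_simplicial_subgroup_def)
  qed
  have "quotient_sgrp X ?L \<in> M_upto n"
    unfolding quotient_in_M_upto_iff[OF X L]
  proof (intro allI impI ballI)
    fix i x assume i: "n < i" and x: "x \<in> carrier (Ob X i)" and a: "\<forall>j<i. face X i j x \<in> ?L (i - 1)"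
    have "face Y i j (f i x) = \<one>\<^bsub>Ob Y (i - 1)\<^esub>" if "j < i" for j
      using a that i x simplicial_homD(2)[OF f face_coface, of i x j] by (auto simp: kernel_def face_def)
    moreover have "f i x \<in> carrier (Ob Y i)" using x f by (blast intro: simplicial_homD(3))
    ultimately have "f i x = \<one>\<^bsub>Ob Y i\<^esub>"
      using Y i trivial_moore_iff[OF sY, of i] by (auto simp: M_upto_def)
    then show "x \<in> ?L i" using x by (simp add: kernel_def)
  qed
  then have sub: "Cot_kernel n X m \<subseteq> ?L m" for m
    using L by (auto simp: Cot_kernel_def)
  have "\<exists>g. g \<in> hom (Ob X m Mod Cot_kernel n X m) (Ob Y m) \<and>
      (\<forall>x\<in>carrier (Ob X m). g (Cot_kernel n X m #>\<^bsub>Ob X m\<^esub> x) = f m x)" for m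
  proof -
    interpret gh: group_hom "Ob X m" "Ob Y m" "f m" by (rule gh)
    interpret normal "Cot_kernel n X m" "Ob X m"
      using K by (simp add: normal_simplicial_subgroup_def)
    have "f m x = f m y" if "x \<in> carrier (Ob X m)" "y \<in> carrier (Ob X m)"
      "Cot_kernel n X m #>\<^bsub>Ob X m\<^esub> x = Cot_kernel n X m #>\<^bsub>Ob X m\<^esub> y" for x y
    proof -
      have "x \<in> Cot_kernel n X m #>\<^bsub>Ob X m\<^esub> y"
        using that gh.G.rcos_self[OF that(1) subgroup_axioms] by simp
      then obtain k where "k \<in> Cot_kernel n X m" "x = k \<otimes>\<^bsub>Ob X m\<^esub> y" by (auto simp: r_coset_def)
      moreover then have "f m k = \<one>\<^bsub>Ob Y m\<^esub>" "k \<in> carrier (Ob X m)"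
        using sub by (auto simp: kernel_def)
      ultimately show ?thesis using that by simp
    qed
    then show ?thesis
      using FactGroup_universal[OF gh.homh normal_axioms] by (metis (no_types, lifting))
  qed
  then obtain g where g: "\<And>m. g m \<in> hom (Ob X m Mod Cot_kernel n X m) (Ob Y m)"
    "\<And>m x. x \<in> carrier (Ob X m) \<Longrightarrow> g m (Cot_kernel n X m #>\<^bsub>Ob X m\<^esub> x) = f m x" by metis
  have "g \<in> simplicial_hom (Cot n X) Y"
  proof (rule simplicial_homI)
    show "g m \<in> hom (Ob (Cot n X) m) (Ob Y m)" for m
      using g by (simp add: Cot_def quotient_sgrp_def)
  next
    fix m l \<theta> c assume "\<theta> \<in> simplex_maps m l" "c \<in> carrier (Ob (Cot n X) l)"
    then show "g m (Act (Cot n X) m l \<theta> c) = Act Y m l \<theta> (g l c)"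
      unfolding Cot_def by (auto simp: carrier_quotient quotient_Act[OF X K] g simplicial_homD(2)[OF f]
          simplicial_groupD(3)[OF X])
  qed
  moreover have "\<forall>m. \<forall>x\<in>carrier (Ob X m). g m (Cot_unit n X m x) = f m x"
    using g by (simp add: Cot_unit_def)
  ultimately show ?thesis
    unfolding Cot_def by (auto simp: carrier_quotient Cot_unit_def intro!: bexI[of _ g])
qed

section \<open>Truncation and coskeleton\<close>

definition tr :: "nat \<Rightarrow> 'a sgrp \<Rightarrow> 'a sgrp" where
  "tr n X = \<lparr>Ob = (\<lambda>k. if k \<le> n then Ob X k else undefined),
     Act = (\<lambda>k l. if k \<le> n \<and> l \<le> n then Act X k l else undefined)\<rparr>"

text \<open>
  The right adjoint of \<open>tr n\<close> is the right Kan extension: level \<open>m\<close> is the limit of \<open>T k\<close> over all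
  \<open>\<theta> : [k] \<rightarrow> [m]\<close> with \<open>k \<le> n\<close>. The universal property is proved below (\<open>cosk_universal\<close>).
\<close>

definition cosk_index :: "nat \<Rightarrow> nat \<Rightarrow> (nat \<times> (nat \<Rightarrow> nat)) set" where
  "cosk_index n m = (SIGMA k:{..n}. simplex_maps k m)"

definition cosk :: "nat \<Rightarrow> 'a sgrp \<Rightarrow> (nat \<times> (nat \<Rightarrow> nat) \<Rightarrow> 'a) sgrp" where
  "cosk n T = \<lparr>
     Ob = (\<lambda>m. (product_group (cosk_index n m) (\<lambda>(k, \<theta>). Ob T k))\<lparr>carrier :=
       {x \<in> \<Pi>\<^sub>E (k, \<theta>)\<in>cosk_index n m. carrier (Ob T k).
         \<forall>(k, \<theta>)\<in>cosk_index n m. \<forall>j\<le>n. \<forall>\<psi>\<in>simplex_maps j k.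
           x (j, compose {..j} \<theta> \<psi>) = Act T j k \<psi> (x (k, \<theta>))}\<rparr>),
     Act = (\<lambda>p m \<phi> x. \<lambda>(k, \<theta>)\<in>cosk_index n p. x (k, compose {..k} \<phi> \<theta>))\<rparr>"

definition cosk_unit :: "nat \<Rightarrow> 'a sgrp \<Rightarrow> nat \<Rightarrow> 'a \<Rightarrow> (nat \<times> (nat \<Rightarrow> nat) \<Rightarrow> 'a)" where
  "cosk_unit n X m x = (\<lambda>(k, \<theta>)\<in>cosk_index n m. Act X k m \<theta> x)"

definition cosk_counit :: "nat \<Rightarrow> (nat \<times> (nat \<Rightarrow> nat) \<Rightarrow> 'a) \<Rightarrow> 'a" where
  "cosk_counit k x = x (k, \<lambda>i\<in>{..k}. i)"

definition F_tr :: "nat \<Rightarrow> 'a sgrp set" where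
  "F_tr n = {X. simplicial_group X \<and> monic X (cosk n (tr n X)) (cosk_unit n X)}"

lemma cosk_index_iff: "(k, \<theta>) \<in> cosk_index n m \<longleftrightarrow> k \<le> n \<and> \<theta> \<in> simplex_maps k m"
  by (simp add: cosk_index_def)

lemma carrier_cosk:
  "x \<in> carrier (Ob (cosk n T) m) \<longleftrightarrow> x \<in> extensional (cosk_index n m) \<and>
    (\<forall>k \<theta>. k \<le> n \<and> \<theta> \<in> simplex_maps k m \<longrightarrow> x (k, \<theta>) \<in> carrier (Ob T k) \<and>
      (\<forall>j\<le>n. \<forall>\<psi>\<in>simplex_maps j k. x (j, compose {..j} \<theta> \<psi>) = Act T j k \<psi> (x (k, \<theta>))))"
  by (auto simp: cosk_def PiE_def Pi_def cosk_index_def)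

lemma cosk_eqI:
  assumes "x \<in> carrier (Ob (cosk n T) m)" "y \<in> carrier (Ob (cosk n T) m)"
    and "\<And>k \<theta>. \<lbrakk>k \<le> n; \<theta> \<in> simplex_maps k m\<rbrakk> \<Longrightarrow> x (k, \<theta>) = y (k, \<theta>)"
  shows "x = y"
proof (rule extensionalityI)
  show "x \<in> extensional (cosk_index n m)" "y \<in> extensional (cosk_index n m)"
    using assms(1,2) by (simp_all add: carrier_cosk)
qed (use assms(3) in \<open>auto simp: cosk_index_iff\<close>)

lemma mult_cosk:
  "x \<otimes>\<^bsub>Ob (cosk n T) m\<^esub> y = (\<lambda>(k, \<theta>)\<in>cosk_index n m. x (k, \<theta>) \<otimes>\<^bsub>Ob T k\<^esub> y (k, \<theta>))"
  by (auto simp: cosk_def restrict_def fun_eq_iff)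

lemma Act_cosk:
  "Act (cosk n T) p m \<phi> x = (\<lambda>(k, \<theta>)\<in>cosk_index n p. x (k, compose {..k} \<phi> \<theta>))"
  by (simp add: cosk_def)

lemma Act_cosk_closed:
  assumes "\<phi> \<in> simplex_maps p m" "x \<in> carrier (Ob (cosk n T) m)"
  shows "Act (cosk n T) p m \<phi> x \<in> carrier (Ob (cosk n T) p)"
proof -
  have "x (j, compose {..j} \<phi> (compose {..j} \<theta> \<psi>)) = Act T j k \<psi> (x (k, compose {..k} \<phi> \<theta>))"
    if "k \<le> n" "\<theta> \<in> simplex_maps k p" "j \<le> n" "\<psi> \<in> simplex_maps j k" for k \<theta> j \<psi>
  proof -
    have "compose {..k} \<phi> \<theta> \<in> simplex_maps k m" using assms that by simp
    then have "x (j, compose {..j} (compose {..k} \<phi> \<theta>) \<psi>) = Act T j k \<psi> (x (k, compose {..k} \<phi> \<theta>))"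
      using assms that by (simp add: carrier_cosk)
    then show ?thesis using simplex_maps_compose_assoc[OF that(4), of \<phi> \<theta>] by simp
  qed
  then show ?thesis using assms by (auto simp: carrier_cosk Act_cosk cosk_index_iff)
qed

lemma simplicial_group_cosk:
  assumes T: "truncated_simplicial_group (enat n) T"
  shows "simplicial_group (cosk n T)"
proof (rule simplicial_groupI)
  interpret T: truncated_simplicial_group "enat n" T by fact
  have gT: "group (Ob T k)" if "k \<le> n" for k using T.group_Ob that by simp
  have hT: "group_hom (Ob T k) (Ob T j) (Act T j k \<psi>)" if "k \<le> n" "j \<le> n" "\<psi> \<in> simplex_maps j k" for j k \<psi>
    using that gT T.Act_hom by (auto intro!: group_hom.intro group_hom_axioms.intro)
  fix m
  let ?P = "product_group (cosk_index n m) (\<lambda>(k, \<theta>). Ob T k)"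
  have gP: "group ?P" using gT by (intro product_group) (auto simp: cosk_index_iff)
  have invP: "inv\<^bsub>?P\<^esub> x = (\<lambda>(k, \<theta>)\<in>cosk_index n m. inv\<^bsub>Ob T k\<^esub> x (k, \<theta>))" if "x \<in> carrier ?P" for x
    using that gT by (subst inv_product_group) (auto simp: cosk_index_iff)
  have car: "carrier (Ob (cosk n T) m) \<subseteq> carrier ?P" by (auto simp: cosk_def)
  have "subgroup (carrier (Ob (cosk n T) m)) ?P"
  proof (rule group.subgroupI[OF gP car])
    show "carrier (Ob (cosk n T) m) \<noteq> {}"
    proof -
      have "Act T j k \<psi> \<one>\<^bsub>Ob T k\<^esub> = \<one>\<^bsub>Ob T j\<^esub>" if "k \<le> n" "j \<le> n" "\<psi> \<in> simplex_maps j k" for j k \<psi>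
        by (rule group_hom.hom_one[OF hT[OF that]])
      then have "(\<lambda>(k, \<theta>)\<in>cosk_index n m. \<one>\<^bsub>Ob T k\<^esub>) \<in> carrier (Ob (cosk n T) m)"
        using gT by (auto simp: carrier_cosk cosk_index_iff group.is_monoid monoid.one_closed)
      then show ?thesis by blast
    qed
  next
    fix x assume x: "x \<in> carrier (Ob (cosk n T) m)"
    show "inv\<^bsub>?P\<^esub> x \<in> carrier (Ob (cosk n T) m)"
    proof (subst invP)
      show "x \<in> carrier ?P" using x car by blast
      have "Act T j k \<psi> (inv\<^bsub>Ob T k\<^esub> z) = inv\<^bsub>Ob T j\<^esub> Act T j k \<psi> z"
        if "k \<le> n" "j \<le> n" "\<psi> \<in> simplex_maps j k" "z \<in> carrier (Ob T k)" for j k \<psi> z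
        by (rule group_hom.hom_inv[OF hT[OF that(1-3)] that(4)])
      then show "(\<lambda>(k, \<theta>)\<in>cosk_index n m. inv\<^bsub>Ob T k\<^esub> x (k, \<theta>)) \<in> carrier (Ob (cosk n T) m)"
        using x gT by (auto simp: carrier_cosk cosk_index_iff group.inv_closed)
    qed
  next
    fix x y assume x: "x \<in> carrier (Ob (cosk n T) m)" "y \<in> carrier (Ob (cosk n T) m)"
    have "x \<otimes>\<^bsub>?P\<^esub> y = x \<otimes>\<^bsub>Ob (cosk n T) m\<^esub> y" by (simp add: cosk_def)
    also have "\<dots> \<in> carrier (Ob (cosk n T) m)"
    proof -
      have "Act T j k \<psi> (z \<otimes>\<^bsub>Ob T k\<^esub> w) = Act T j k \<psi> z \<otimes>\<^bsub>Ob T j\<^esub> Act T j k \<psi> w"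
        if "k \<le> n" "j \<le> n" "\<psi> \<in> simplex_maps j k" "z \<in> carrier (Ob T k)" "w \<in> carrier (Ob T k)"
        for j k \<psi> z w
        by (rule group_hom.hom_mult[OF hT[OF that(1-3)] that(4,5)])
      then show ?thesis
        using x gT unfolding mult_cosk
        by (auto simp: carrier_cosk cosk_index_iff group.is_monoid monoid.m_closed)
    qed
    finally show "x \<otimes>\<^bsub>?P\<^esub> y \<in> carrier (Ob (cosk n T) m)" .
  qed
  then have "group (?P\<lparr>carrier := carrier (Ob (cosk n T) m)\<rparr>)"
    by (rule subgroup.subgroup_is_group[OF _ gP])
  moreover have "?P\<lparr>carrier := carrier (Ob (cosk n T) m)\<rparr> = Ob (cosk n T) m"
    by (simp add: cosk_def)
  ultimately show "group (Ob (cosk n T) m)" by simp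
next
  fix m l \<phi> assume \<phi>: "\<phi> \<in> simplex_maps m l"
  show "Act (cosk n T) m l \<phi> \<in> hom (Ob (cosk n T) l) (Ob (cosk n T) m)"
    using \<phi> by (intro homI Act_cosk_closed)
      (auto simp: mult_cosk Act_cosk restrict_def fun_eq_iff cosk_index_iff)
next
  fix m x assume x: "x \<in> carrier (Ob (cosk n T) m)"
  show "Act (cosk n T) m m (\<lambda>i\<in>{..m}. i) x = x"
    by (rule cosk_eqI[OF Act_cosk_closed[OF simplex_maps_id x] x])
      (simp add: Act_cosk cosk_index_iff simplex_maps_compose_id)
next
  fix p m l \<phi> \<theta> x
  assume \<phi>: "\<phi> \<in> simplex_maps p m" and \<theta>: "\<theta> \<in> simplex_maps m l" and x: "x \<in> carrier (Ob (cosk n T) l)"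
  show "Act (cosk n T) p l (compose {..p} \<theta> \<phi>) x = Act (cosk n T) p m \<phi> (Act (cosk n T) m l \<theta> x)"
    using \<phi> \<theta> x by (intro cosk_eqI[of _ n T p] Act_cosk_closed)
      (auto simp: Act_cosk cosk_index_iff simplex_maps_compose_assoc)
qed

lemma truncated_simplicial_group_tr:
  assumes "simplicial_group X"
  shows "truncated_simplicial_group (enat n) (tr n X)"
  by (rule truncated_simplicial_group.intro) (auto simp: tr_def simplicial_groupD[OF assms])

lemma cosk_counit_hom:
  assumes T: "truncated_simplicial_group (enat n) T"
  shows "cosk_counit \<in> truncated_hom (enat n) (tr n (cosk n T)) T"
proof -
  have "cosk_counit k \<in> hom (Ob (cosk n T) k) (Ob T k)" if "k \<le> n" for k
    using that by (auto intro!: homI simp: cosk_counit_def carrier_cosk mult_cosk cosk_index_iff)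
  moreover have "cosk_counit k (Act (cosk n T) k l \<theta> x) = Act T k l \<theta> (cosk_counit l x)"
    if "k \<le> n" "l \<le> n" "\<theta> \<in> simplex_maps k l" "x \<in> carrier (Ob (cosk n T) l)" for k l \<theta> x
  proof -
    have "x (k, compose {..k} (\<lambda>i\<in>{..l}. i) \<theta>) = Act T k l \<theta> (x (l, \<lambda>i\<in>{..l}. i))"
      using that by (auto simp: carrier_cosk)
    then show ?thesis using that
      by (simp add: cosk_counit_def Act_cosk cosk_index_iff simplex_maps_compose_id)
  qed
  ultimately show ?thesis by (auto simp: truncated_hom_def tr_def)
qed

lemma cosk_universal:
  fixes Y :: "'b sgrp"
  assumes T: "truncated_simplicial_group (enat n) T" and Y: "simplicial_group Y"
    and g: "g \<in> truncated_hom (enat n) (tr n Y) T"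
  shows "\<exists>f\<in>simplicial_hom Y (cosk n T).
      (\<forall>k\<le>n. \<forall>y\<in>carrier (Ob Y k). cosk_counit k (f k y) = g k y) \<and>
      (\<forall>f'\<in>simplicial_hom Y (cosk n T).
         (\<forall>k\<le>n. \<forall>y\<in>carrier (Ob Y k). cosk_counit k (f' k y) = g k y) \<longrightarrow>
         (\<forall>m. \<forall>y\<in>carrier (Ob Y m). f' m y = f m y))"
proof -
  have gh: "g k \<in> hom (Ob Y k) (Ob T k)" if "k \<le> n" for k
    using g that by (auto simp: truncated_hom_def tr_def split: if_splits)
  have gn: "g k (Act Y k l \<theta> y) = Act T k l \<theta> (g l y)"
    if "k \<le> n" "l \<le> n" "\<theta> \<in> simplex_maps k l" "y \<in> carrier (Ob Y l)" for k l \<theta> y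
    using g that by (auto simp: truncated_hom_def tr_def)
  have gc: "g k y \<in> carrier (Ob T k)" if "k \<le> n" "y \<in> carrier (Ob Y k)" for k y
    using gh[OF that(1)] that(2) by (auto simp: hom_def Pi_iff)
  define f where "f = (\<lambda>m y. \<lambda>(k, \<theta>)\<in>cosk_index n m. g k (Act Y k m \<theta> y))"
  have fc: "f m y \<in> carrier (Ob (cosk n T) m)" if "y \<in> carrier (Ob Y m)" for m y
    using that by (auto simp: f_def carrier_cosk cosk_index_iff gc gn simplicial_groupD[OF Y])
  have "f \<in> simplicial_hom Y (cosk n T)"
  proof (rule simplicial_homI)
    fix m show "f m \<in> hom (Ob Y m) (Ob (cosk n T) m)"
    proof (rule homI)
      fix x y assume xy: "x \<in> carrier (Ob Y m)" "y \<in> carrier (Ob Y m)"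
      have "g k (Act Y k m \<theta> (x \<otimes>\<^bsub>Ob Y m\<^esub> y)) = g k (Act Y k m \<theta> x) \<otimes>\<^bsub>Ob T k\<^esub> g k (Act Y k m \<theta> y)"
        if "k \<le> n" "\<theta> \<in> simplex_maps k m" for k \<theta>
        using xy that gh[OF that(1)] simplicial_groupD(2,3)[OF Y that(2)] by (simp add: hom_mult)
      then show "f m (x \<otimes>\<^bsub>Ob Y m\<^esub> y) = f m x \<otimes>\<^bsub>Ob (cosk n T) m\<^esub> f m y"
        by (auto simp: f_def mult_cosk restrict_def fun_eq_iff cosk_index_iff)
    qed (rule fc)
  next
    fix p m \<phi> y assume "\<phi> \<in> simplex_maps p m" "y \<in> carrier (Ob Y m)"
    then show "f p (Act Y p m \<phi> y) = Act (cosk n T) p m \<phi> (f m y)"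
      by (intro cosk_eqI[of _ n T p] fc Act_cosk_closed)
        (auto simp: simplicial_groupD[OF Y] f_def Act_cosk cosk_index_iff)
  qed
  moreover have "\<forall>k\<le>n. \<forall>y\<in>carrier (Ob Y k). cosk_counit k (f k y) = g k y"
    by (auto simp: cosk_counit_def f_def cosk_index_iff simplicial_groupD[OF Y])
  moreover have "f' m y = f m y"
    if f': "f' \<in> simplicial_hom Y (cosk n T)"
      and c: "\<forall>k\<le>n. \<forall>y\<in>carrier (Ob Y k). cosk_counit k (f' k y) = g k y"
      and y: "y \<in> carrier (Ob Y m)" for f' m y
  proof (rule cosk_eqI[OF simplicial_homD(3)[OF f' y] fc[OF y]])
    fix k \<theta> assume k: "k \<le> n" "\<theta> \<in> simplex_maps k m"
    have "f' m y (k, \<theta>) = cosk_counit k (Act (cosk n T) k m \<theta> (f' m y))"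
      using k by (simp add: cosk_counit_def Act_cosk cosk_index_iff simplex_maps_compose_id)
    also have "\<dots> = cosk_counit k (f' k (Act Y k m \<theta> y))"
      using simplicial_homD(2)[OF f' k(2) y] by simp
    also have "\<dots> = g k (Act Y k m \<theta> y)"
      using c k simplicial_groupD(3)[OF Y k(2) y] by blast
    finally show "f' m y (k, \<theta>) = f m y (k, \<theta>)" using k by (simp add: f_def cosk_index_iff)
  qed
  ultimately show ?thesis by blast
qed

text \<open>The unit is the morphism that corresponds to the identity of \<open>tr n X\<close>.\<close>

lemma cosk_unit:
  assumes X: "simplicial_group X"
  shows "cosk_unit n X \<in> simplicial_hom X (cosk n (tr n X))"
    and "\<lbrakk>k \<le> n; x \<in> carrier (Ob X k)\<rbrakk> \<Longrightarrow> cosk_counit k (cosk_unit n X k x) = x"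
proof -
  have closed: "cosk_unit n X m x \<in> carrier (Ob (cosk n (tr n X)) m)" if "x \<in> carrier (Ob X m)" for m x
    using that by (auto simp: cosk_unit_def carrier_cosk cosk_index_iff tr_def simplicial_groupD[OF X])
  show "cosk_unit n X \<in> simplicial_hom X (cosk n (tr n X))"
  proof (rule simplicial_homI)
    fix m show "cosk_unit n X m \<in> hom (Ob X m) (Ob (cosk n (tr n X)) m)"
      by (intro homI closed)
        (auto simp: cosk_unit_def mult_cosk restrict_def fun_eq_iff cosk_index_iff tr_def
          hom_mult[OF simplicial_groupD(2)[OF X]])
  next
    fix p m \<phi> x assume "\<phi> \<in> simplex_maps p m" "x \<in> carrier (Ob X m)"
    then show "cosk_unit n X p (Act X p m \<phi> x) = Act (cosk n (tr n X)) p m \<phi> (cosk_unit n X m x)"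
      by (intro cosk_eqI[of _ n "tr n X" p] closed Act_cosk_closed)
        (auto simp: simplicial_groupD[OF X] cosk_unit_def Act_cosk cosk_index_iff)
  qed
  show "\<lbrakk>k \<le> n; x \<in> carrier (Ob X k)\<rbrakk> \<Longrightarrow> cosk_counit k (cosk_unit n X k x) = x"
    by (simp add: cosk_counit_def cosk_unit_def cosk_index_iff simplicial_groupD[OF X])
qed

section \<open>The torsion theories\<close>

text \<open>A torsion theory is recorded as the pair (torsion objects, torsion-free objects).\<close>

definition mu_upto :: "nat \<Rightarrow> 'a sgrp set \<times> 'a sgrp set" where
  "mu_upto n = (Ker_Cot n, M_upto n)"

definition mu_from :: "nat \<Rightarrow> 'a sgrp set \<times> 'a sgrp set" where
  "mu_from n = (M_from n, F_tr (n - 1))"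

text \<open>
  For torsion theories \<open>\<sigma> = (S, G) \<le> \<tau> = (T, F)\<close>, the pretorsion theory \<open>(T, G)\<close> and its class of trivial
  objects.
\<close>

definition pretorsion_pair ::
    "'a sgrp set \<times> 'a sgrp set \<Rightarrow> 'a sgrp set \<times> 'a sgrp set \<Rightarrow> 'a sgrp set \<times> 'a sgrp set" where
  "pretorsion_pair \<sigma> \<tau> = (fst \<tau>, snd \<sigma>)"

definition trivial_objects :: "'a sgrp set \<times> 'a sgrp set \<Rightarrow> 'a sgrp set" where
  "trivial_objects P = fst P \<inter> snd P"

section \<open>The Dold--Kan functor and Eilenberg--Mac Lane simplicial groups\<close>

text \<open>A chain complex of abelian groups, in degrees \<open>\<ge> 0\<close>; \<open>Bd C k\<close> maps degree \<open>k\<close> to degree \<open>k - 1\<close>.\<close>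

record 'a chain_complex =
  Ch :: "nat \<Rightarrow> 'a monoid"
  Bd :: "nat \<Rightarrow> 'a \<Rightarrow> 'a"

definition simplex_epis :: "nat \<Rightarrow> (nat \<times> (nat \<Rightarrow> nat)) set" where
  "simplex_epis m = (SIGMA k:{..m}. {\<eta> \<in> simplex_maps m k. \<eta> ` {..m} = {..k}})"

definition simplex_monos :: "nat \<Rightarrow> nat \<Rightarrow> (nat \<Rightarrow> nat) set" where
  "simplex_monos q k = {\<epsilon> \<in> simplex_maps q k. inj_on \<epsilon> {..q}}"

text \<open>
  The contravariant action of an injection \<open>\<epsilon> : [q] \<rightarrow> [k]\<close> on a chain complex: the differential for the
  last coface (the Moore differential is the last face), and zero for all other proper injections.
\<close>

definition chain_act :: "'a chain_complex \<Rightarrow> nat \<Rightarrow> nat \<Rightarrow> (nat \<Rightarrow> nat) \<Rightarrow> 'a \<Rightarrow> 'a" where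
  "chain_act C q k \<epsilon> a =
     (if q = k then a
      else if k = Suc q \<and> \<epsilon> = coface q k then Bd C k a
      else \<one>\<^bsub>Ch C q\<^esub>)"

text \<open>
  Level \<open>m\<close> is the direct sum of \<open>C k\<close> over all surjections \<open>\<eta> : [m] \<rightarrow> [k]\<close>. For \<open>\<theta> : [p] \<rightarrow> [m]\<close>, the
  summand of \<open>\<eta>\<close> is sent by \<open>chain_act\<close> of \<open>\<epsilon>\<close> to the summand of \<open>\<sigma>\<close>, where \<open>\<eta> \<circ> \<theta> = \<epsilon> \<circ> \<sigma>\<close> is the
  epi-mono factorization.
\<close>

definition Dold_Kan :: "'a chain_complex \<Rightarrow> (nat \<times> (nat \<Rightarrow> nat) \<Rightarrow> 'a) sgrp" where
  "Dold_Kan C = \<lparr>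
     Ob = (\<lambda>m. product_group (simplex_epis m) (\<lambda>(k, \<eta>). Ch C k)),
     Act = (\<lambda>p m \<theta> a. \<lambda>(q, \<sigma>)\<in>simplex_epis p.
       finprod (Ch C q) (\<lambda>(k, \<eta>, \<epsilon>). chain_act C q k \<epsilon> (a (k, \<eta>)))
         {(k, \<eta>, \<epsilon>). (k, \<eta>) \<in> simplex_epis m \<and> \<epsilon> \<in> simplex_monos q k \<and>
            compose {..p} \<epsilon> \<sigma> = compose {..p} \<eta> \<theta>})\<rparr>"

definition concentrated :: "'a monoid \<Rightarrow> nat \<Rightarrow> 'a chain_complex" where
  "concentrated A n = \<lparr>
     Ch = (\<lambda>k. if k = n then A else A\<lparr>carrier := {\<one>\<^bsub>A\<^esub>}\<rparr>),
     Bd = (\<lambda>k a. \<one>\<^bsub>A\<^esub>)\<rparr>"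

definition EM :: "'a monoid \<Rightarrow> nat \<Rightarrow> (nat \<times> (nat \<Rightarrow> nat) \<Rightarrow> 'a) sgrp" where
  "EM A n = Dold_Kan (concentrated A n)"

end

theory Submission
  imports Defs
begin

text \<open>
  Both halves rest on the classical descent argument (\<open>descent_to_moore\<close>): if the faces
  \<open>d\<^sub>0 x, \<dots>, d\<^sub>m\<^sub>-\<^sub>1 x\<close> of \<open>x \<in> X\<^sub>m\<close> lie in a simplicial subgroup \<open>H\<close>, then a right factor from \<open>H\<close> moves
  \<open>x\<close> into the Moore complex. It says in particular that the Moore complex together with the
  degeneracies generates \<open>X\<close>.

  The second conjunct. Let \<open>K\<^sub>m\<close> consist of the \<open>x \<in> X\<^sub>m\<close> all of whose images in \<open>X\<^sub>n\<close>
  are boundaries of the Moore complex. This is a normal simplicial subgroup, with \<open>K\<^sub>n\<close> the boundaries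
  and \<open>K\<^sub>m = 1\<close> for \<open>m < n\<close>, and it contains \<open>N(X)\<^sub>i\<close> for every \<open>i > n\<close>. By descent \<open>X / K\<close> has no Moore
  complex above \<open>n\<close>, so it is a quotient of \<open>Cot\<^sub>n X\<close>. If \<open>Cot\<^sub>n X = 0\<close>, then \<open>K = X\<close>: the levels below
  \<open>n\<close> vanish and every element of \<open>X\<^sub>n\<close> is a boundary (\<open>Ker_Cot_levels\<close>, \<open>Ker_Cot_trivial_below\<close>).
  This gives \<open>\<pi>\<^sub>k = 0\<close> for \<open>k \<le> n\<close>. In degree \<open>k > n\<close>, every operator that is not surjective kills a
  Moore cycle, so the cycle vanishes in the \<open>n\<close>-coskeleton, and it is trivial if \<open>X\<close> embeds there
  (\<open>F_tr_cycles_trivial\<close>).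

  The first conjunct. Here the trivial objects are the \<open>X\<close> with \<open>N(X)\<^sub>i = 1\<close> for \<open>i \<noteq> n\<close>. Then \<open>X\<^sub>m = 1\<close> for \<open>m < n\<close>, all
  of \<open>X\<^sub>n\<close> consists of cycles, and \<open>\<pi>\<^sub>n(X) = X\<^sub>n\<close>. Elements above level \<open>n\<close> are determined by their
  faces other than the last one; comparing two products of degenerate elements in \<open>X\<^sub>n\<^sub>+\<^sub>1\<close> therefore
  shows that \<open>X\<^sub>n\<close> is abelian (\<open>comm_level\<close>), and then so is every level. For an abelian group \<open>B\<close>
  isomorphic to \<open>X\<^sub>n\<close>, a family \<open>(b\<^sub>\<eta>)\<close> indexed by the surjections \<open>\<eta> : [m] \<rightarrow> [n]\<close> is sent to the product
  of the degenerate elements \<open>\<eta>\<^sup>* b\<^sub>\<eta>\<close>. This comparison map \<open>dk : K(B, n) \<rightarrow> X\<close> is natural, since an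
  operator composed with \<open>\<eta>\<close> either is again a surjection onto \<open>[n]\<close> or acts trivially on \<open>X\<^sub>n\<close>. It is
  injective because the last sections of the surjections make it triangular (\<open>dk_eq_one\<close>), and
  surjective by descent applied to its image (\<open>dk_surj\<close>).
\<close>

section \<open>Operators of the simplex category\<close>

definition codegeneracy :: "nat \<Rightarrow> nat \<Rightarrow> nat \<Rightarrow> nat" where
  "codegeneracy n j = (\<lambda>i\<in>{..Suc n}. if i \<le> j then i else i - 1)"

definition degeneracy :: "'a sgrp \<Rightarrow> nat \<Rightarrow> nat \<Rightarrow> 'a \<Rightarrow> 'a" where
  "degeneracy X n j = Act X (Suc n) n (codegeneracy n j)"

lemma codegeneracy_simplex_maps [simp]:
  "j \<le> n \<Longrightarrow> codegeneracy n j \<in> simplex_maps (Suc n) n"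
  by (auto simp: codegeneracy_def simplex_maps_def mono_on_def)

lemma simplex_maps_mono: "\<lbrakk>\<theta> \<in> simplex_maps m n; i \<le> j; j \<le> m\<rbrakk> \<Longrightarrow> \<theta> i \<le> \<theta> j"
  by (auto simp: simplex_maps_def mono_on_def)

lemma simplex_maps_eqI:
  assumes "\<theta> \<in> simplex_maps m n" "\<theta>' \<in> simplex_maps m n" "\<And>i. i \<le> m \<Longrightarrow> \<theta> i = \<theta>' i"
  shows "\<theta> = \<theta>'"
  using assms by (auto simp: simplex_maps_def PiE_def intro: extensionalityI)

lemma finite_simplex_maps: "finite (simplex_maps m n)"
  by (rule finite_subset[of _ "{..m} \<rightarrow>\<^sub>E {..n}"]) (auto simp: simplex_maps_def intro: finite_PiE)

lemma coface_coface:
  "i \<le> j \<Longrightarrow> compose {..n} (coface (Suc n) (Suc j)) (coface n i) = compose {..n} (coface (Suc n) i) (coface n j)"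
  by (auto simp: compose_def coface_def fun_eq_iff)

lemma codegeneracy_coface_id:
  "j \<le> n \<Longrightarrow> i = j \<or> i = Suc j \<Longrightarrow> compose {..n} (codegeneracy n j) (coface n i) = (\<lambda>i\<in>{..n}. i)"
  by (auto simp: compose_def coface_def codegeneracy_def fun_eq_iff)

lemma codegeneracy_coface_less:
  "\<lbrakk>i \<le> j; j \<le> n\<rbrakk> \<Longrightarrow> compose {..Suc n} (codegeneracy (Suc n) (Suc j)) (coface (Suc n) i)
     = compose {..Suc n} (coface n i) (codegeneracy n j)"
  by (auto simp: compose_def coface_def codegeneracy_def fun_eq_iff)

lemma codegeneracy_coface_not_id:
  assumes "j \<le> n" "i \<le> Suc n" "i \<noteq> j" "i \<noteq> Suc j"
  shows "compose {..n} (codegeneracy n j) (coface n i) \<noteq> (\<lambda>i\<in>{..n}. i)"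
proof
  assume *: "compose {..n} (codegeneracy n j) (coface n i) = (\<lambda>i\<in>{..n}. i)"
  show False
    using assms fun_cong[OF *, of i] fun_cong[OF *, of "i - 1"]
    by (auto simp: compose_def coface_def codegeneracy_def split: if_splits)
qed

text \<open>Through this factorization, triviality of one face forces triviality of many operators.\<close>

lemma missing_value_factor:
  assumes \<theta>: "\<theta> \<in> simplex_maps p n" and j: "j \<le> n" "j \<notin> \<theta> ` {..p}"
  obtains \<theta>' where "0 < n" "\<theta>' \<in> simplex_maps p (n - 1)" "\<theta> = compose {..p} (coface (n - 1) j) \<theta>'"
proof
  define \<theta>' where "\<theta>' = (\<lambda>i\<in>{..p}. if \<theta> i < j then \<theta> i else \<theta> i - 1)"
  have ne: "\<theta> i \<noteq> j" if "i \<le> p" for i using j that by auto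
  have le: "\<theta> i \<le> n" if "i \<le> p" for i using simplex_maps_le[OF \<theta> that] .
  show n: "0 < n" using ne[of 0] le[of 0] j by auto
  show "\<theta>' \<in> simplex_maps p (n - 1)"
  proof -
    have "\<theta>' i \<le> n - 1" if "i \<le> p" for i
      using ne[OF that] le[OF that] j that by (auto simp: \<theta>'_def)
    moreover have "\<theta>' i \<le> \<theta>' k" if "i \<le> k" "k \<le> p" for i k
      using ne[of i] ne[of k] simplex_maps_mono[OF \<theta> that] that by (auto simp: \<theta>'_def)
    moreover have "\<theta>' \<in> extensional {..p}" by (simp add: \<theta>'_def)
    ultimately show ?thesis by (auto simp: simplex_maps_def mono_on_def PiE_iff)
  qed
  have "\<theta> i = compose {..p} (coface (n - 1) j) \<theta>' i" for i
  proof (cases "i \<le> p")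
    case True
    then show ?thesis using ne[OF True] le[OF True] n j(1)
      by (auto simp: compose_def coface_def \<theta>'_def)
  next
    case False
    then show ?thesis using \<theta> by (auto simp: simplex_maps_def PiE_iff extensional_def compose_def)
  qed
  then show "\<theta> = compose {..p} (coface (n - 1) j) \<theta>'" by blast
qed

lemma surjection_le:
  assumes "\<eta> \<in> simplex_maps m n" "\<eta> ` {..m} = {..n}"
  shows "n \<le> m"
  using card_image_le[of "{..m}" \<eta>] assms by simp

text \<open>Counting makes \<open>\<theta>\<close> injective, hence strictly increasing, which bounds it by the identity from both sides.\<close>

lemma surj_endo_eq_id:
  assumes \<theta>: "\<theta> \<in> simplex_maps n n" and s: "\<theta> ` {..n} = {..n}"
  shows "\<theta> = (\<lambda>i\<in>{..n}. i)"
proof (rule simplex_maps_eqI[OF \<theta> simplex_maps_id])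
  have inj: "inj_on \<theta> {..n}" by (rule eq_card_imp_inj_on) (simp_all add: s)
  have st: "\<theta> i < \<theta> k" if "i < k" "k \<le> n" for i k
    using simplex_maps_mono[OF \<theta>, of i k] inj that by (fastforce simp: inj_on_def order.order_iff_strict)
  have up: "i \<le> \<theta> i" if "i \<le> n" for i
    using that
  proof (induction i)
    case (Suc i)
    then show ?case using st[of i "Suc i"] by simp
  qed simp
  have down: "\<theta> (n - k) \<le> n - k" if "k \<le> n" for k
    using that
  proof (induction k)
    case 0
    then show ?case using simplex_maps_le[OF \<theta>, of n] by simp
  next
    case (Suc k)
    then have "\<theta> (n - Suc k) < \<theta> (n - k)" by (intro st) auto
    then show ?case using Suc by simp
  qed
  fix i assume "i \<le> n"
  then show "\<theta> i = (\<lambda>i\<in>{..n}. i) i" using up[of i] down[of "n - i"] by simp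
qed

text \<open>
  The last section of a surjection \<open>\<eta>\<close> sends \<open>i\<close> to the greatest point over \<open>i\<close>. It orders the
  surjections: it can be a section of a second one only if that one lies pointwise below \<open>\<eta>\<close>.
\<close>

lemma last_section:
  assumes \<eta>: "\<eta> \<in> simplex_maps m n" and s: "\<eta> ` {..m} = {..n}"
  obtains \<delta> where "\<delta> \<in> simplex_maps n m" "compose {..n} \<eta> \<delta> = (\<lambda>i\<in>{..n}. i)"
    "\<And>\<eta>' i. \<lbrakk>\<eta>' \<in> simplex_maps m n; compose {..n} \<eta>' \<delta> = (\<lambda>i\<in>{..n}. i); i \<le> m\<rbrakk> \<Longrightarrow> \<eta>' i \<le> \<eta> i"
proof
  define F where "F = (\<lambda>i. {j. j \<le> m \<and> \<eta> j = i})"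
  define \<delta> where "\<delta> = (\<lambda>i\<in>{..n}. Max (F i))"
  have fin: "finite (F i)" for i by (simp add: F_def)
  have ne: "F i \<noteq> {}" if "i \<le> n" for i using s that by (force simp: F_def)
  have \<delta>: "\<delta> i \<le> m" "\<eta> (\<delta> i) = i" if "i \<le> n" for i
    using Max_in[OF fin ne[OF that]] that by (auto simp: \<delta>_def F_def)
  have above: "j \<le> \<delta> (\<eta> j)" if "j \<le> m" for j
    using that simplex_maps_le[OF \<eta> that] by (auto simp: \<delta>_def F_def intro: Max_ge)
  show \<delta>_map: "\<delta> \<in> simplex_maps n m"
  proof -
    have "\<delta> i \<le> \<delta> k" if "i \<le> k" "k \<le> n" for i k
    proof (cases "i = k")
      case False
      show ?thesis
      proof (rule ccontr)
        assume "\<not> \<delta> i \<le> \<delta> k"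
        then have "\<eta> (\<delta> k) \<le> \<eta> (\<delta> i)" using simplex_maps_mono[OF \<eta>, of "\<delta> k" "\<delta> i"] \<delta> that by simp
        then show False using \<delta> that False by simp
      qed
    qed simp
    then show ?thesis using \<delta> by (auto simp: simplex_maps_def mono_on_def \<delta>_def)
  qed
  show "compose {..n} \<eta> \<delta> = (\<lambda>i\<in>{..n}. i)" using \<delta> by (auto simp: compose_def)
  fix \<eta>' i
  assume \<eta>': "\<eta>' \<in> simplex_maps m n" and id: "compose {..n} \<eta>' \<delta> = (\<lambda>i\<in>{..n}. i)" and i: "i \<le> m"
  have k: "\<eta> i \<le> n" using simplex_maps_le[OF \<eta> i] .
  have "\<eta>' (\<delta> (\<eta> i)) = \<eta> i" using fun_cong[OF id, of "\<eta> i"] k by (simp add: compose_def)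
  then show "\<eta>' i \<le> \<eta> i" using simplex_maps_mono[OF \<eta>' above[OF i]] \<delta>(1)[OF k] by simp
qed

section \<open>Faces, degeneracies and the descent to the Moore complex\<close>

lemma (in group) mult_in_subgroup_imp_left:
  assumes "subgroup H G" "x \<in> carrier G" "h \<in> carrier G" "h \<in> H" "x \<otimes> h \<in> H"
  shows "x \<in> H"
proof -
  have "x = x \<otimes> h \<otimes> inv h" using assms by (simp add: m_assoc)
  also have "\<dots> \<in> H" using assms by (simp add: subgroup.m_closed subgroup.m_inv_closed)
  finally show ?thesis .
qed

context
  fixes X :: "'a sgrp"
  assumes X: "simplicial_group X"
begin

lemma sgrp_group: "group (Ob X n)"
  by (rule simplicial_groupD(1)[OF X])

lemma face_group_hom: "group_hom (Ob X (Suc n)) (Ob X n) (face X (Suc n) i)"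
  using Act_group_hom[OF X coface_simplex_maps] by (simp add: face_def)

lemma degeneracy_group_hom: "j \<le> n \<Longrightarrow> group_hom (Ob X n) (Ob X (Suc n)) (degeneracy X n j)"
  using Act_group_hom[OF X codegeneracy_simplex_maps] by (simp add: degeneracy_def)

lemma face_face:
  assumes "i \<le> j" "x \<in> carrier (Ob X (Suc (Suc n)))"
  shows "face X (Suc n) i (face X (Suc (Suc n)) (Suc j) x) = face X (Suc n) j (face X (Suc (Suc n)) i x)"
  using assms by (simp add: face_def flip: simplicial_groupD(5)[OF X]) (simp add: coface_coface)

lemma face_degeneracy_id:
  assumes "j \<le> n" "i = j \<or> i = Suc j" "x \<in> carrier (Ob X n)"
  shows "face X (Suc n) i (degeneracy X n j x) = x"
  using assms by (simp only: face_def degeneracy_def diff_Suc_1 codegeneracy_coface_id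
      simplicial_groupD(4)[OF X] coface_simplex_maps codegeneracy_simplex_maps
      simplicial_groupD(5)[OF X, symmetric])

lemma face_degeneracy_less:
  assumes "i < j" "j \<le> Suc n" "x \<in> carrier (Ob X (Suc n))"
  shows "face X (Suc (Suc n)) i (degeneracy X (Suc n) j x) = degeneracy X n (j - 1) (face X (Suc n) i x)"
proof -
  obtain k where k: "j = Suc k" using assms by (cases j) auto
  show ?thesis
    using assms unfolding k face_def degeneracy_def
    by (simp flip: simplicial_groupD(5)[OF X]) (simp add: codegeneracy_coface_less)
qed

text \<open>
  The faces are cleared one after another: the degenerate element built from the face of index \<open>j\<close>
  cancels that face, and its faces of smaller index are trivial by the simplicial identities.
\<close>

lemma descent_to_moore:
  assumes H: "\<And>m. subgroup (H m) (Ob X m)"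
    and act: "\<And>m n \<theta> h. \<lbrakk>\<theta> \<in> simplex_maps m n; h \<in> H n\<rbrakk> \<Longrightarrow> Act X m n \<theta> h \<in> H m"
    and x: "x \<in> carrier (Ob X (Suc m))" and faces: "\<And>j. j \<le> m \<Longrightarrow> face X (Suc m) j x \<in> H m"
  obtains h where "h \<in> H (Suc m)" "x \<otimes>\<^bsub>Ob X (Suc m)\<^esub> h \<in> carrier (moore X (Suc m))"
proof -
  interpret G: group "Ob X (Suc m)" by (rule sgrp_group)
  interpret S: subgroup "H (Suc m)" "Ob X (Suc m)" by (rule H)
  interpret G': group "Ob X m" by (rule sgrp_group)
  interpret S': subgroup "H m" "Ob X m" by (rule H)
  \<comment> \<open>\<open>j\<close> counts the faces that have been cleared already.\<close>
  have "\<exists>h\<in>H (Suc m). \<forall>i<j. face X (Suc m) i (x \<otimes>\<^bsub>Ob X (Suc m)\<^esub> h) = \<one>\<^bsub>Ob X m\<^esub>" if "j \<le> Suc m" for j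
    using that
  proof (induction j)
    case 0
    show ?case using S.one_closed by blast
  next
    case (Suc j)
    then have j: "j \<le> m" by simp
    from Suc obtain h where h: "h \<in> H (Suc m)"
      and i: "\<And>i. i < j \<Longrightarrow> face X (Suc m) i (x \<otimes>\<^bsub>Ob X (Suc m)\<^esub> h) = \<one>\<^bsub>Ob X m\<^esub>" by auto
    define y where "y = x \<otimes>\<^bsub>Ob X (Suc m)\<^esub> h"
    define z where "z = face X (Suc m) j y"
    define s where "s = degeneracy X m j z"
    interpret d: group_hom "Ob X (Suc m)" "Ob X m" "face X (Suc m) k" for k by (rule face_group_hom)
    interpret s: group_hom "Ob X m" "Ob X (Suc m)" "degeneracy X m j" by (rule degeneracy_group_hom[OF j])
    have y: "y \<in> carrier (Ob X (Suc m))" using x h by (simp add: y_def)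
    have "face X (Suc m) j h \<in> H m" using act[OF coface_simplex_maps h] by (simp add: face_def)
    then have z: "z \<in> H m" using faces[OF j] x h by (simp add: z_def y_def)
    then have s: "s \<in> H (Suc m)" using act[OF codegeneracy_simplex_maps[OF j]] by (simp add: s_def degeneracy_def)
    have zc: "z \<in> carrier (Ob X m)" using z by simp
    have fs: "face X (Suc m) i s = \<one>\<^bsub>Ob X m\<^esub>" if ij: "i < j" for i
    proof -
      obtain k where m: "m = Suc k" using ij j by (cases m) auto
      interpret s': group_hom "Ob X k" "Ob X m" "degeneracy X k (j - 1)"
        using degeneracy_group_hom[of "j - 1" k] j by (simp add: m)
      interpret d': group_hom "Ob X m" "Ob X k" "face X m l" for l
        using face_group_hom by (simp add: m)
      have "face X (Suc m) i s = degeneracy X k (j - 1) (face X m i z)"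
        using face_degeneracy_less[of i j k z] ij j zc by (simp add: s_def m)
      also have "face X m i z = face X m (j - 1) (face X (Suc m) i y)"
        using face_face[of i "j - 1" y k] ij y by (simp add: z_def m)
      finally show ?thesis using i[OF ij] by (simp add: y_def del: One_nat_def)
    qed
    have "face X (Suc m) i (y \<otimes>\<^bsub>Ob X (Suc m)\<^esub> inv\<^bsub>Ob X (Suc m)\<^esub> s) = \<one>\<^bsub>Ob X m\<^esub>" if "i < Suc j" for i
    proof (cases "i = j")
      case True
      have "face X (Suc m) j s = z" using face_degeneracy_id[OF j] z by (simp add: s_def)
      then show ?thesis using True y s z by (simp add: z_def)
    next
      case False
      then show ?thesis using that i fs y s by (simp add: y_def)
    qed
    moreover have "y \<otimes>\<^bsub>Ob X (Suc m)\<^esub> inv\<^bsub>Ob X (Suc m)\<^esub> s = x \<otimes>\<^bsub>Ob X (Suc m)\<^esub> (h \<otimes>\<^bsub>Ob X (Suc m)\<^esub> inv\<^bsub>Ob X (Suc m)\<^esub> s)"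
      using x h s by (simp add: y_def G.m_assoc)
    ultimately show ?case using h s
      by (intro bexI[of _ "h \<otimes>\<^bsub>Ob X (Suc m)\<^esub> inv\<^bsub>Ob X (Suc m)\<^esub> s"]) auto
  qed
  from this[of "Suc m"] obtain h where "h \<in> H (Suc m)"
    "\<forall>i<Suc m. face X (Suc m) i (x \<otimes>\<^bsub>Ob X (Suc m)\<^esub> h) = \<one>\<^bsub>Ob X m\<^esub>" by auto
  then show ?thesis using x by (intro that[of h]) (auto simp: carrier_moore)
qed

lemma Act_eq_one_if_face_eq_one:
  assumes \<theta>: "\<theta> \<in> simplex_maps p n" and j: "j \<le> n" "j \<notin> \<theta> ` {..p}"
    and x: "x \<in> carrier (Ob X n)" "face X n j x = \<one>\<^bsub>Ob X (n - 1)\<^esub>"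
  shows "Act X p n \<theta> x = \<one>\<^bsub>Ob X p\<^esub>"
proof -
  obtain \<theta>' where *: "0 < n" "\<theta>' \<in> simplex_maps p (n - 1)" "\<theta> = compose {..p} (coface (n - 1) j) \<theta>'"
    by (rule missing_value_factor[OF \<theta> j])
  interpret group_hom "Ob X (n - 1)" "Ob X p" "Act X p (n - 1) \<theta>'" by (rule Act_group_hom[OF X *(2)])
  have "Act X p n \<theta> x = Act X p (n - 1) \<theta>' (face X n j x)"
    unfolding *(3) face_def by (rule simplicial_groupD(5)[OF X *(2) face_coface[OF *(1)] x(1)])
  also have "\<dots> = \<one>\<^bsub>Ob X p\<^esub>" unfolding x(2) by (rule hom_one)
  finally show ?thesis .
qed

lemma moore_subset: "carrier (moore X n) \<subseteq> carrier (Ob X n)"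
  by (auto simp: carrier_moore)

lemma trivial_moore_iff_subset: "trivial_group (moore X n) \<longleftrightarrow> carrier (moore X n) \<subseteq> {\<one>\<^bsub>Ob X n\<^esub>}"
  unfolding trivial_moore_iff[OF X] by (auto simp: carrier_moore)

lemma subgroup_moore: "subgroup (carrier (moore X n)) (Ob X n)"
proof (cases n)
  case 0
  then show ?thesis using group.subgroup_self[OF sgrp_group] by (simp add: moore_def)
next
  case (Suc k)
  interpret group "Ob X (Suc k)" by (rule sgrp_group)
  interpret d: group_hom "Ob X (Suc k)" "Ob X k" "face X (Suc k) i" for i by (rule face_group_hom)
  show ?thesis unfolding Suc by (rule subgroupI) (auto simp: carrier_moore)
qed

lemma moore_conj_closed:
  assumes g: "g \<in> carrier (Ob X n)" and y: "y \<in> carrier (moore X n)"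
  shows "g \<otimes>\<^bsub>Ob X n\<^esub> y \<otimes>\<^bsub>Ob X n\<^esub> inv\<^bsub>Ob X n\<^esub> g \<in> carrier (moore X n)"
proof (cases n)
  case 0
  interpret group "Ob X 0" by (rule sgrp_group)
  show ?thesis using g y by (simp add: carrier_moore 0)
next
  case (Suc k)
  interpret group "Ob X (Suc k)" by (rule sgrp_group)
  interpret d: group_hom "Ob X (Suc k)" "Ob X k" "face X (Suc k) i" for i by (rule face_group_hom)
  show ?thesis using g y by (auto simp: carrier_moore Suc)
qed

text \<open>A conjugate of a boundary is the boundary of a conjugate by a degenerate element.\<close>

lemma normal_moore_boundaries: "moore_boundaries X n \<lhd> Ob X n"
proof -
  interpret G: group "Ob X n" by (rule sgrp_group)
  interpret d: group_hom "Ob X (Suc n)" "Ob X n" "face X (Suc n) (Suc n)" by (rule face_group_hom)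
  interpret s: group_hom "Ob X n" "Ob X (Suc n)" "degeneracy X n n" by (rule degeneracy_group_hom) simp
  have "g \<otimes>\<^bsub>Ob X n\<^esub> z \<otimes>\<^bsub>Ob X n\<^esub> inv\<^bsub>Ob X n\<^esub> g \<in> moore_boundaries X n"
    if g: "g \<in> carrier (Ob X n)" and z: "z \<in> moore_boundaries X n" for g z
  proof -
    from z obtain y where y: "y \<in> carrier (moore X (Suc n))" "z = face X (Suc n) (Suc n) y"
      by (auto simp: moore_boundaries_def)
    let ?s = "degeneracy X n n g"
    have "face X (Suc n) (Suc n) ?s = g" using face_degeneracy_id[of n n "Suc n" g] g by simp
    then have "g \<otimes>\<^bsub>Ob X n\<^esub> z \<otimes>\<^bsub>Ob X n\<^esub> inv\<^bsub>Ob X n\<^esub> g =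
        face X (Suc n) (Suc n) (?s \<otimes>\<^bsub>Ob X (Suc n)\<^esub> y \<otimes>\<^bsub>Ob X (Suc n)\<^esub> inv\<^bsub>Ob X (Suc n)\<^esub> ?s)"
      using y g moore_subset by (auto simp: subset_iff)
    then show ?thesis using moore_conj_closed[OF s.hom_closed[OF g] y(1)]
      by (auto simp: moore_boundaries_def)
  qed
  moreover have "subgroup (moore_boundaries X n) (Ob X n)"
    unfolding moore_boundaries_def by (rule d.subgroup_img_is_subgroup[OF subgroup_moore])
  ultimately show ?thesis by (simp add: G.normal_inv_iff)
qed

lemma moore_cycles_0: "moore_cycles X 0 = carrier (Ob X 0)"
  by (simp add: moore_cycles_def carrier_moore)

lemma moore_cycles_Suc:
  "moore_cycles X (Suc n) =
     {x \<in> carrier (Ob X (Suc n)). \<forall>i\<le>Suc n. face X (Suc n) i x = \<one>\<^bsub>Ob X n\<^esub>}"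
proof -
  have "\<one>\<^bsub>moore X n\<^esub> = \<one>\<^bsub>Ob X n\<^esub>" by (simp add: moore_def)
  then show ?thesis by (auto simp: moore_cycles_def kernel_def carrier_moore le_Suc_eq less_Suc_eq_le)
qed

lemma moore_cycles_subset: "moore_cycles X n \<subseteq> carrier (Ob X n)"
  by (cases n) (auto simp: moore_cycles_0 moore_cycles_Suc)

lemma subgroup_moore_cycles: "subgroup (moore_cycles X n) (Ob X n)"
proof (cases n)
  case 0
  then show ?thesis using group.subgroup_self[OF sgrp_group] by (simp add: moore_cycles_0)
next
  case (Suc k)
  interpret group "Ob X (Suc k)" by (rule sgrp_group)
  interpret d: group_hom "Ob X (Suc k)" "Ob X k" "face X (Suc k) i" for i by (rule face_group_hom)
  show ?thesis unfolding Suc moore_cycles_Suc by (rule subgroupI) auto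
qed

lemma moore_boundaries_subset_cycles: "moore_boundaries X n \<subseteq> moore_cycles X n"
proof (cases n)
  case 0
  then show ?thesis using normal_imp_subgroup[OF normal_moore_boundaries, THEN subgroup.subset]
    by (simp add: moore_cycles_0)
next
  case (Suc k)
  interpret d: group_hom "Ob X (Suc k)" "Ob X k" "face X (Suc k) i" for i by (rule face_group_hom)
  interpret d': group_hom "Ob X (Suc (Suc k))" "Ob X (Suc k)" "face X (Suc (Suc k)) i" for i
    by (rule face_group_hom)
  show ?thesis
    by (auto simp: moore_boundaries_def moore_cycles_Suc carrier_moore Suc face_face)
qed

text \<open>All faces of a cycle are trivial, and an operator that is not surjective starts with a face.\<close>

lemma Act_moore_cycle_eq_one:
  assumes x: "x \<in> moore_cycles X n" and \<theta>: "\<theta> \<in> simplex_maps p n" "\<theta> ` {..p} \<noteq> {..n}"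
  shows "Act X p n \<theta> x = \<one>\<^bsub>Ob X p\<^esub>"
proof -
  have "\<theta> ` {..p} \<subseteq> {..n}" using simplex_maps_le[OF \<theta>(1)] by auto
  then obtain j where j: "j \<le> n" "j \<notin> \<theta> ` {..p}" using \<theta>(2) by auto
  have "0 < n" using missing_value_factor[OF \<theta>(1) j] by blast
  then obtain k where "n = Suc k" by (cases n) auto
  then show ?thesis
    using x j by (intro Act_eq_one_if_face_eq_one[OF \<theta>(1) j]) (auto simp: moore_cycles_Suc)
qed

lemma trivial_homotopy_group:
  assumes "moore_cycles X k \<subseteq> moore_boundaries X k"
  shows "trivial_group (homotopy_group X k)"
proof -
  let ?G = "(Ob X k)\<lparr>carrier := moore_cycles X k\<rparr>"
  have eq: "moore_boundaries X k = carrier ?G" using assms moore_boundaries_subset_cycles by auto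
  interpret group ?G by (rule subgroup.subgroup_is_group[OF subgroup_moore_cycles sgrp_group])
  interpret N: normal "carrier ?G" ?G by (rule normal_self)
  have h: "homotopy_group X k = ?G Mod carrier ?G"
    by (simp add: homotopy_group_def eq moore_def)
  have "carrier ?G #>\<^bsub>?G\<^esub> x = carrier ?G" if "x \<in> carrier ?G" for x
    using coset_join2[OF that subgroup_self that] .
  then have "carrier (?G Mod carrier ?G) = {carrier ?G}"
    using one_closed unfolding carrier_FactGroup by blast
  then show ?thesis
    unfolding h trivial_group_def one_FactGroup using N.factorgroup_is_group by blast
qed

end

section \<open>The kernel of the reflector and the coskeletal objects\<close>

text \<open>
  The largest simplicial subgroup whose level \<open>n\<close> consists of boundaries. Defining it by a condition on
  all operators makes its closure under operators immediate.
\<close>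

definition boundary_saturation :: "nat \<Rightarrow> 'a sgrp \<Rightarrow> nat \<Rightarrow> 'a set" where
  "boundary_saturation n X m =
     {x \<in> carrier (Ob X m). \<forall>\<theta>\<in>simplex_maps n m. Act X n m \<theta> x \<in> moore_boundaries X n}"

lemma boundary_saturation_self:
  assumes X: "simplicial_group X"
  shows "boundary_saturation n X n = moore_boundaries X n"
proof
  show "boundary_saturation n X n \<subseteq> moore_boundaries X n"
    using simplicial_groupD(4)[OF X] by (force simp: boundary_saturation_def intro: simplex_maps_id)
  interpret N: normal "moore_boundaries X n" "Ob X n" by (rule normal_moore_boundaries[OF X])
  show "moore_boundaries X n \<subseteq> boundary_saturation n X n"
  proof
    fix z assume z: "z \<in> moore_boundaries X n"
    have "Act X n n \<theta> z \<in> moore_boundaries X n" if "\<theta> \<in> simplex_maps n n" for \<theta>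
    proof (cases "\<theta> ` {..n} = {..n}")
      case True
      then show ?thesis using surj_endo_eq_id[OF that] simplicial_groupD(4)[OF X] z by simp
    next
      case False
      have "z \<in> moore_cycles X n" using moore_boundaries_subset_cycles[OF X] z by blast
      then have "Act X n n \<theta> z = \<one>\<^bsub>Ob X n\<^esub>" by (rule Act_moore_cycle_eq_one[OF X _ that False])
      then show ?thesis by simp
    qed
    then show "z \<in> boundary_saturation n X n" using z by (simp add: boundary_saturation_def)
  qed
qed

lemma normal_simplicial_boundary_saturation:
  assumes X: "simplicial_group X"
  shows "normal_simplicial_subgroup X (boundary_saturation n X)"
proof -
  interpret N: normal "moore_boundaries X n" "Ob X n" by (rule normal_moore_boundaries[OF X])
  have "boundary_saturation n X m \<lhd> Ob X m" for m
  proof -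
    interpret G: group "Ob X m" by (rule simplicial_groupD(1)[OF X])
    have h: "group_hom (Ob X m) (Ob X n) (Act X n m \<theta>)" if "\<theta> \<in> simplex_maps n m" for \<theta>
      by (rule Act_group_hom[OF X that])
    note [simp] = group_hom.hom_one[OF h] group_hom.hom_mult[OF h] group_hom.hom_inv[OF h]
      group_hom.hom_closed[OF h]
    have "subgroup (boundary_saturation n X m) (Ob X m)"
      by (rule G.subgroupI) (auto simp: boundary_saturation_def intro!: exI[of _ "\<one>\<^bsub>Ob X m\<^esub>"])
    moreover have "g \<otimes>\<^bsub>Ob X m\<^esub> x \<otimes>\<^bsub>Ob X m\<^esub> inv\<^bsub>Ob X m\<^esub> g \<in> boundary_saturation n X m"
      if "g \<in> carrier (Ob X m)" "x \<in> boundary_saturation n X m" for g x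
      using that by (auto simp: boundary_saturation_def intro!: N.inv_op_closed2)
    ultimately show ?thesis by (simp add: G.normal_inv_iff)
  qed
  moreover have "Act X l m \<theta> x \<in> boundary_saturation n X l"
    if "\<theta> \<in> simplex_maps l m" "x \<in> boundary_saturation n X m" for l m \<theta> x
    using that by (auto simp: boundary_saturation_def simplicial_groupD(3)[OF X]
        simp flip: simplicial_groupD(5)[OF X])
  ultimately show ?thesis by (auto simp: normal_simplicial_subgroup_def)
qed

text \<open>
  Only the last face of an element of the Moore complex can be nontrivial, and in degree \<open>n + 1\<close> that
  face is by definition a boundary.
\<close>

lemma moore_subset_boundary_saturation:
  assumes X: "simplicial_group X" and i: "n < i"
  shows "carrier (moore X i) \<subseteq> boundary_saturation n X i"
proof
  fix y assume y: "y \<in> carrier (moore X i)"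
  then have yc: "y \<in> carrier (Ob X i)" using moore_subset[OF X] by blast
  interpret N: normal "moore_boundaries X n" "Ob X n" by (rule normal_moore_boundaries[OF X])
  have "Act X n i \<theta> y \<in> moore_boundaries X n" if \<theta>: "\<theta> \<in> simplex_maps n i" for \<theta>
  proof (cases "\<exists>j<i. j \<notin> \<theta> ` {..n}")
    case True
    then obtain j where "j < i" "j \<notin> \<theta> ` {..n}" by blast
    then show ?thesis
      using Act_eq_one_if_face_eq_one[OF X \<theta>, of j y] y by (auto simp: carrier_moore)
  next
    case False
    \<comment> \<open>An operator that hits all of \<open>{..<i}\<close> leaves only the face of index \<open>i = n + 1\<close>.\<close>
    then have sub: "{..<i} \<subseteq> \<theta> ` {..n}" by auto
    from card_mono[OF _ this] card_image_le[of "{..n}" \<theta>] i have si: "i = Suc n" by simp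
    with sub i have im: "\<theta> ` {..n} = {..<i}"
      using card_seteq[OF _ sub] card_image_le[of "{..n}" \<theta>] by simp
    then have "i \<notin> \<theta> ` {..n}" by auto
    from missing_value_factor[OF \<theta> order_refl this] obtain \<theta>' where
      \<theta>': "\<theta>' \<in> simplex_maps n n" "\<theta> = compose {..n} (coface n i) \<theta>'" by (auto simp: si)
    have "\<theta>' k = \<theta> k" if "k \<le> n" for k
      using simplex_maps_le[OF \<theta>'(1) that] that by (simp add: \<theta>'(2) compose_def coface_def si)
    then have "\<theta>' ` {..n} = {..n}" using im by (force simp: si)
    then have "\<theta>' = (\<lambda>i\<in>{..n}. i)" by (rule surj_endo_eq_id[OF \<theta>'(1)])
    then have "\<theta> = coface n (Suc n)"
      using simplex_maps_compose_id(1)[OF coface_simplex_maps] \<theta>'(2) by (simp add: si)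
    then show ?thesis using y by (auto simp: moore_boundaries_def face_def si)
  qed
  then show "y \<in> boundary_saturation n X i" using yc by (simp add: boundary_saturation_def)
qed

text \<open>
  If the faces of \<open>x\<close> in degree \<open>i > n\<close> lie in the saturation, descent corrects \<open>x\<close> within the
  saturation to an element of the Moore complex, which lies in the saturation as well.
\<close>

lemma Cot_kernel_subset_boundary_saturation:
  assumes X: "simplicial_group X"
  shows "Cot_kernel n X m \<subseteq> boundary_saturation n X m"
proof -
  let ?K = "boundary_saturation n X"
  note K = normal_simplicial_boundary_saturation[OF X, of n]
  have sub: "subgroup (?K m) (Ob X m)" for m
    using K by (simp add: normal_simplicial_subgroup_def normal_imp_subgroup)
  have desc: "x \<in> ?K i" if i: "n < i" and x: "x \<in> carrier (Ob X i)" and f: "\<forall>j<i. face X i j x \<in> ?K (i - 1)" for i x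
  proof -
    obtain k where k: "i = Suc k" using i by (cases i) auto
    have act: "Act X m l \<theta> h \<in> ?K m" if "\<theta> \<in> simplex_maps m l" "h \<in> ?K l" for m l \<theta> h
    proof -
      have "Act X m l \<theta> ` ?K l \<subseteq> ?K m" using K that(1) by (simp add: normal_simplicial_subgroup_def)
      then show ?thesis using that(2) by (rule subsetD[OF _ imageI])
    qed
    have x': "x \<in> carrier (Ob X (Suc k))" using x k by simp
    have f': "face X (Suc k) j x \<in> ?K k" if "j \<le> k" for j using f k that by simp
    obtain h where h: "h \<in> ?K i" "x \<otimes>\<^bsub>Ob X i\<^esub> h \<in> carrier (moore X i)"
      using descent_to_moore[OF X sub act x' f'] unfolding k by blast
    then have "x \<otimes>\<^bsub>Ob X i\<^esub> h \<in> ?K i" using moore_subset_boundary_saturation[OF X i] by blast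
    moreover have "h \<in> carrier (Ob X i)" using h(1) subgroup.subset[OF sub] by blast
    ultimately show ?thesis
      by (intro group.mult_in_subgroup_imp_left[OF simplicial_groupD(1)[OF X] sub x _ h(1)])
  qed
  have "quotient_sgrp X ?K \<in> M_upto n"
    unfolding quotient_in_M_upto_iff[OF X K] by (intro allI impI ballI) (rule desc)
  then have "?K m \<in> {K m |K. normal_simplicial_subgroup X K \<and> quotient_sgrp X K \<in> M_upto n}"
    using K by blast
  then show ?thesis unfolding Cot_kernel_def by (rule Inter_lower)
qed

lemma Ker_Cot_levels:
  assumes "X \<in> Ker_Cot n"
  shows "carrier (Ob X m) = boundary_saturation n X m"
proof -
  have X: "simplicial_group X" and z: "trivial_group (Ob (Cot n X) m)" for m
    using assms by (auto simp: Ker_Cot_def zero_sgrp_def)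
  note K = normal_simplicial_Cot_kernel[OF X, of n]
  have "x \<in> Cot_kernel n X m" if "x \<in> carrier (Ob X m)" for x
    using z[of m] that rcos_eq_iff[OF X K that]
    by (auto simp: trivial_group_def Cot_def carrier_quotient one_quotient)
  then show ?thesis using Cot_kernel_subset_boundary_saturation[OF X, of n m]
    by (auto simp: boundary_saturation_def)
qed

lemma Ker_Cot_trivial_below:
  assumes "X \<in> Ker_Cot n" "m < n"
  shows "carrier (Ob X m) = {\<one>\<^bsub>Ob X m\<^esub>}"
proof -
  have X: "simplicial_group X" using assms by (simp add: Ker_Cot_def)
  interpret G: group "Ob X m" by (rule simplicial_groupD(1)[OF X])
  have "x = \<one>\<^bsub>Ob X m\<^esub>" if x: "x \<in> carrier (Ob X m)" for x
  proof -
    \<comment> \<open>\<open>\<sigma>\<close> degenerates \<open>x\<close> to level \<open>n\<close>, where it is a boundary, and \<open>\<delta>\<close> retracts it back along faces.\<close>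
    define \<sigma> where "\<sigma> = (\<lambda>i\<in>{..n}. min i m)"
    define \<delta> where "\<delta> = (\<lambda>i\<in>{..m}. i)"
    have \<sigma>: "\<sigma> \<in> simplex_maps n m" by (auto simp: simplex_maps_def mono_on_def \<sigma>_def)
    have \<delta>: "\<delta> \<in> simplex_maps m n" using assms by (auto simp: simplex_maps_def mono_on_def \<delta>_def)
    have "compose {..m} \<sigma> \<delta> = (\<lambda>i\<in>{..m}. i)" using assms by (auto simp: compose_def \<sigma>_def \<delta>_def)
    then have "x = Act X m n \<delta> (Act X n m \<sigma> x)"
      using simplicial_groupD(5)[OF X \<delta> \<sigma> x] simplicial_groupD(4)[OF X x] by simp
    also have "\<dots> = \<one>\<^bsub>Ob X m\<^esub>"
    proof (rule Act_moore_cycle_eq_one[OF X _ \<delta>])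
      show "Act X n m \<sigma> x \<in> moore_cycles X n"
        using Ker_Cot_levels[OF assms(1), of m] x \<sigma> moore_boundaries_subset_cycles[OF X]
        by (auto simp: boundary_saturation_def)
      have "n \<notin> \<delta> ` {..m}" using assms by (auto simp: \<delta>_def)
      then show "\<delta> ` {..m} \<noteq> {..n}" by auto
    qed
    finally show ?thesis .
  qed
  then show ?thesis by auto
qed

text \<open>
  A cycle in degree \<open>k > n\<close> has no nontrivial operator down to a level \<open>\<le> n\<close>, so the coskeleton
  does not see it.
\<close>

lemma F_tr_cycles_trivial:
  assumes F: "X \<in> F_tr n" and k: "n < k"
  shows "moore_cycles X k = {\<one>\<^bsub>Ob X k\<^esub>}"
proof -
  have X: "simplicial_group X" using F by (simp add: F_tr_def)
  have inj: "inj_on (cosk_unit n X k) (carrier (Ob X k))"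
    using F monic_iff[OF X simplicial_group_cosk[OF truncated_simplicial_group_tr[OF X]]]
    by (auto simp: F_tr_def)
  have one: "\<one>\<^bsub>Ob X k\<^esub> \<in> moore_cycles X k"
    by (rule subgroup.one_closed[OF subgroup_moore_cycles[OF X]])
  have "Act X l k \<theta> x = \<one>\<^bsub>Ob X l\<^esub>"
    if "x \<in> moore_cycles X k" "l \<le> n" "\<theta> \<in> simplex_maps l k" for x l \<theta>
    using surjection_le[OF that(3)] that k by (intro Act_moore_cycle_eq_one[OF X]) auto
  then have "cosk_unit n X k x = cosk_unit n X k \<one>\<^bsub>Ob X k\<^esub>" if "x \<in> moore_cycles X k" for x
    using that one by (auto simp: cosk_unit_def cosk_index_iff restrict_def fun_eq_iff)
  then show ?thesis using inj one moore_cycles_subset[OF X] by (auto dest: inj_onD)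
qed

theorem Ker_Cot_F_tr_aspherical:
  assumes "X \<in> Ker_Cot n" "X \<in> F_tr n"
  shows "trivial_group (homotopy_group X k)"
proof -
  have X: "simplicial_group X" using assms by (simp add: Ker_Cot_def)
  have one: "\<one>\<^bsub>Ob X k\<^esub> \<in> moore_boundaries X k"
    using normal_imp_subgroup[OF normal_moore_boundaries[OF X]] by (rule subgroup.one_closed)
  consider "k < n" | "k = n" | "n < k" by linarith
  then have "moore_cycles X k \<subseteq> moore_boundaries X k"
  proof cases
    case 1
    then show ?thesis using Ker_Cot_trivial_below[OF assms(1) 1] moore_cycles_subset[OF X, of k] one by auto
  next
    case 2
    then show ?thesis
      using Ker_Cot_levels[OF assms(1), of n] boundary_saturation_self[OF X, of n]
        moore_cycles_subset[OF X, of n] by simp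
  next
    case 3
    then show ?thesis using F_tr_cycles_trivial[OF assms(2)] one by simp
  qed
  then show ?thesis by (rule trivial_homotopy_group[OF X])
qed

section \<open>Simplicial groups with Moore complex concentrated in one degree\<close>

locale concentrated_sgrp =
  fixes X :: "'a sgrp" and n :: nat
  assumes X: "simplicial_group X" and pos: "0 < n"
    and conc: "i \<noteq> n \<Longrightarrow> trivial_group (moore X i)"
begin

text \<open>The quotient of two elements with equal faces, the last one excepted, lies in the Moore complex.\<close>

lemma eq_if_faces_eq:
  assumes m: "Suc m \<noteq> n" and xy: "x \<in> carrier (Ob X (Suc m))" "y \<in> carrier (Ob X (Suc m))"
    and f: "\<And>j. j \<le> m \<Longrightarrow> face X (Suc m) j x = face X (Suc m) j y"
  shows "x = y"
proof -
  interpret G: group "Ob X (Suc m)" by (rule sgrp_group[OF X])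
  interpret d: group_hom "Ob X (Suc m)" "Ob X m" "face X (Suc m) i" for i by (rule face_group_hom[OF X])
  have "x \<otimes>\<^bsub>Ob X (Suc m)\<^esub> inv\<^bsub>Ob X (Suc m)\<^esub> y \<in> carrier (moore X (Suc m))"
    using xy f by (auto simp: carrier_moore)
  then have "x \<otimes>\<^bsub>Ob X (Suc m)\<^esub> inv\<^bsub>Ob X (Suc m)\<^esub> y = \<one>\<^bsub>Ob X (Suc m)\<^esub>"
    using conc[OF m] trivial_moore_iff_subset[OF X] by blast
  then have "inv\<^bsub>Ob X (Suc m)\<^esub> (inv\<^bsub>Ob X (Suc m)\<^esub> y) = x"
    using xy by (intro G.inv_equality) auto
  then show ?thesis using xy by simp
qed

lemma trivial_below: "m < n \<Longrightarrow> carrier (Ob X m) = {\<one>\<^bsub>Ob X m\<^esub>}"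
proof (induction m)
  case 0
  then show ?case using conc[of 0] trivial_moore_iff_subset[OF X, of 0]
      group.is_monoid[OF sgrp_group[OF X], THEN monoid.one_closed] by (auto simp: carrier_moore)
next
  case (Suc m)
  interpret G: group "Ob X (Suc m)" by (rule sgrp_group[OF X])
  have f: "face X (Suc m) j x = \<one>\<^bsub>Ob X m\<^esub>" if "x \<in> carrier (Ob X (Suc m))" for j x
    using face_closed[OF X _ that, of j] Suc by simp
  have "x = \<one>\<^bsub>Ob X (Suc m)\<^esub>" if "x \<in> carrier (Ob X (Suc m))" for x
    by (rule eq_if_faces_eq[of m]) (use that Suc.prems f in auto)
  then show ?case by auto
qed

lemma moore_cycles_eq: "moore_cycles X n = carrier (Ob X n)"
proof -
  obtain k where k: "n = Suc k" using pos by (cases n) auto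
  have "face X (Suc k) i x = \<one>\<^bsub>Ob X k\<^esub>" if "x \<in> carrier (Ob X (Suc k))" for i x
    using face_closed[OF X _ that, of i] trivial_below[of k] k by simp
  then show ?thesis by (auto simp: k moore_cycles_Suc[OF X])
qed

lemma Act_non_surj:
  "\<lbrakk>\<theta> \<in> simplex_maps p n; \<theta> ` {..p} \<noteq> {..n}; x \<in> carrier (Ob X n)\<rbrakk> \<Longrightarrow> Act X p n \<theta> x = \<one>\<^bsub>Ob X p\<^esub>"
  using Act_moore_cycle_eq_one[OF X] moore_cycles_eq by blast

lemma face_degeneracy_other:
  assumes "j \<le> n" "i \<le> Suc n" "i \<noteq> j" "i \<noteq> Suc j" "x \<in> carrier (Ob X n)"
  shows "face X (Suc n) i (degeneracy X n j x) = \<one>\<^bsub>Ob X n\<^esub>"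
proof -
  let ?\<theta> = "compose {..n} (codegeneracy n j) (coface n i)"
  have \<theta>: "?\<theta> \<in> simplex_maps n n"
    by (rule simplex_maps_compose[OF coface_simplex_maps codegeneracy_simplex_maps[OF assms(1)]])
  have "face X (Suc n) i (degeneracy X n j x) = Act X n n ?\<theta> x"
    using assms simplicial_groupD(5)[OF X coface_simplex_maps codegeneracy_simplex_maps]
    by (simp add: face_def degeneracy_def)
  also have "\<dots> = \<one>\<^bsub>Ob X n\<^esub>"
    using surj_endo_eq_id[OF \<theta>] codegeneracy_coface_not_id[OF assms(1-4)]
    by (intro Act_non_surj[OF \<theta> _ assms(5)]) blast
  finally show ?thesis .
qed

text \<open>
  Two products of degenerate elements agree on all faces but the last, hence are equal, and their last
  faces are \<open>y\<close> and \<open>x y x\<inverse>\<close>. There is room for two distinct degeneracies because \<open>n > 0\<close>.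
\<close>

lemma comm_level: "comm_group (Ob X n)"
proof -
  interpret G: group "Ob X n" by (rule sgrp_group[OF X])
  interpret G1: group "Ob X (Suc n)" by (rule sgrp_group[OF X])
  interpret d: group_hom "Ob X (Suc n)" "Ob X n" "face X (Suc n) i" for i by (rule face_group_hom[OF X])
  obtain k where k: "n = Suc k" using pos by (cases n) auto
  show ?thesis
  proof (rule G.group_comm_groupI)
    fix x y assume x: "x \<in> carrier (Ob X n)" and y: "y \<in> carrier (Ob X n)"
    \<comment> \<open>Writing \<open>s\<close> for degeneracies, \<open>u = s\<^sub>n\<^sub>-\<^sub>1 x \<cdot> s\<^sub>n y\<close> and \<open>v = s\<^sub>n (x y x\<inverse>) \<cdot> s\<^sub>n\<^sub>-\<^sub>1 x\<close>. In both the face \<open>n - 1\<close> is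
      \<open>x\<close>, the face \<open>n\<close> is \<open>x y\<close>, and all earlier ones are trivial.\<close>
    define z where "z = x \<otimes>\<^bsub>Ob X n\<^esub> y \<otimes>\<^bsub>Ob X n\<^esub> inv\<^bsub>Ob X n\<^esub> x"
    have z: "z \<in> carrier (Ob X n)" using x y by (simp add: z_def)
    have s: "degeneracy X n j w \<in> carrier (Ob X (Suc n))" if "j \<le> n" "w \<in> carrier (Ob X n)" for j w
      using group_hom.hom_closed[OF degeneracy_group_hom[OF X that(1)] that(2)] .
    define u where "u = degeneracy X n k x \<otimes>\<^bsub>Ob X (Suc n)\<^esub> degeneracy X n n y"
    define v where "v = degeneracy X n n z \<otimes>\<^bsub>Ob X (Suc n)\<^esub> degeneracy X n k x"
    have kn: "k \<le> n" "k \<noteq> n" "k \<noteq> Suc n" using k by auto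
    have f: "face X (Suc n) i (degeneracy X n k w) = (if i = k \<or> i = n then w else \<one>\<^bsub>Ob X n\<^esub>)"
      "face X (Suc n) i (degeneracy X n n w) = (if i = n \<or> i = Suc n then w else \<one>\<^bsub>Ob X n\<^esub>)"
      if "i \<le> Suc n" "w \<in> carrier (Ob X n)" for i w
      using that face_degeneracy_id[OF X, of k n i w] face_degeneracy_id[OF X, of n n i w]
        face_degeneracy_other[of k i w] face_degeneracy_other[of n i w] k by auto
    have "face X (Suc n) i u = face X (Suc n) i v" if "i \<le> n" for i
      using x y z s[of k x] s[of n y] s[of n z] kn that
      by (auto simp: u_def v_def f z_def G.m_assoc)
    moreover have "u \<in> carrier (Ob X (Suc n))" "v \<in> carrier (Ob X (Suc n))"
      using x y z s kn by (auto simp: u_def v_def)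
    ultimately have "u = v" using eq_if_faces_eq[of n u v] by simp
    then have "face X (Suc n) (Suc n) u = face X (Suc n) (Suc n) v" by simp
    then have "y = z" using x y z s[of k x] s[of n y] s[of n z] kn by (auto simp: u_def v_def f)
    then have "y \<otimes>\<^bsub>Ob X n\<^esub> x = z \<otimes>\<^bsub>Ob X n\<^esub> x" by simp
    then show "x \<otimes>\<^bsub>Ob X n\<^esub> y = y \<otimes>\<^bsub>Ob X n\<^esub> x" using x y by (simp add: z_def G.m_assoc)
  qed
qed

lemma comm_levels: "comm_group (Ob X m)"
proof (induction m)
  case 0
  interpret G: group "Ob X 0" by (rule sgrp_group[OF X])
  show ?case using trivial_below[OF pos] by (intro G.group_comm_groupI) auto
next
  case (Suc m)
  show ?case
  proof (cases "Suc m = n")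
    case False
    interpret G: group "Ob X (Suc m)" by (rule sgrp_group[OF X])
    interpret C: comm_group "Ob X m" by (rule Suc.IH)
    interpret d: group_hom "Ob X (Suc m)" "Ob X m" "face X (Suc m) i" for i by (rule face_group_hom[OF X])
    show ?thesis
    proof (rule G.group_comm_groupI)
      fix x y assume xy: "x \<in> carrier (Ob X (Suc m))" "y \<in> carrier (Ob X (Suc m))"
      then have "face X (Suc m) j (x \<otimes>\<^bsub>Ob X (Suc m)\<^esub> y) = face X (Suc m) j (y \<otimes>\<^bsub>Ob X (Suc m)\<^esub> x)" for j
        by (simp add: C.m_comm)
      then show "x \<otimes>\<^bsub>Ob X (Suc m)\<^esub> y = y \<otimes>\<^bsub>Ob X (Suc m)\<^esub> x"
        by (rule eq_if_faces_eq[OF False, rotated 2]) (use xy in auto)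
    qed
  qed (use comm_level in simp)
qed

lemma homotopy_group_eq: "homotopy_group X n = Ob X n Mod {\<one>\<^bsub>Ob X n\<^esub>}"
proof -
  interpret d: group_hom "Ob X (Suc n)" "Ob X n" "face X (Suc n) i" for i by (rule face_group_hom[OF X])
  have "carrier (moore X (Suc n)) = {\<one>\<^bsub>Ob X (Suc n)\<^esub>}"
    using conc[of "Suc n"] by (simp add: trivial_group_def moore_def)
  then have "moore_boundaries X n = {\<one>\<^bsub>Ob X n\<^esub>}" by (simp add: moore_boundaries_def)
  then show ?thesis by (simp add: homotopy_group_def moore_cycles_eq moore_def)
qed

end

section \<open>Eilenberg--Mac Lane objects\<close>

definition epis :: "nat \<Rightarrow> nat \<Rightarrow> (nat \<Rightarrow> nat) set" where
  "epis m n = {\<eta> \<in> simplex_maps m n. \<eta> ` {..m} = {..n}}"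

lemma simplex_epis_iff: "(k, \<eta>) \<in> simplex_epis m \<longleftrightarrow> \<eta> \<in> epis m k"
  using surjection_le by (auto simp: simplex_epis_def epis_def)

lemma finite_epis: "finite (epis m n)"
  by (rule finite_subset[OF _ finite_simplex_maps]) (auto simp: epis_def)

lemma epis_self: "epis n n = {\<lambda>i\<in>{..n}. i}"
  using surj_endo_eq_id by (auto simp: epis_def)

lemma simplex_monos_self: "simplex_monos n n = {\<lambda>i\<in>{..n}. i}"
proof -
  have "\<epsilon> = (\<lambda>i\<in>{..n}. i)" if "\<epsilon> \<in> simplex_monos n n" for \<epsilon>
  proof (rule surj_endo_eq_id)
    show "\<epsilon> \<in> simplex_maps n n" using that by (simp add: simplex_monos_def)
    then have "\<epsilon> ` {..n} \<subseteq> {..n}" by (auto simp: simplex_maps_le)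
    then show "\<epsilon> ` {..n} = {..n}" using that by (intro endo_inj_surj) (auto simp: simplex_monos_def)
  qed
  moreover have "(\<lambda>i\<in>{..n}. i) \<in> simplex_monos n n" by (simp add: simplex_monos_def inj_on_def)
  ultimately show ?thesis by blast
qed

context
  fixes B :: "'b monoid" and n :: nat
  assumes B: "comm_group B"
begin

lemma comm_group_Ch: "comm_group (Ch (concentrated B n) k)"
proof (cases "k = n")
  case False
  interpret B: comm_group B by (rule B)
  have "group (B\<lparr>carrier := {\<one>\<^bsub>B\<^esub>}\<rparr>)"
    by (rule subgroup.subgroup_is_group[OF B.triv_subgroup B.group_axioms])
  then show ?thesis using False by (auto simp: concentrated_def intro!: group.group_comm_groupI)
qed (simp add: concentrated_def B)

lemma carrier_EM:
  "a \<in> carrier (Ob (EM B n) m) \<longleftrightarrow> a \<in> extensional (simplex_epis m) \<and>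
     (\<forall>k. \<forall>\<eta>\<in>epis m k. a (k, \<eta>) \<in> carrier (Ch (concentrated B n) k))"
proof -
  have "(\<forall>i\<in>simplex_epis m. P i) \<longleftrightarrow> (\<forall>k. \<forall>\<eta>\<in>epis m k. P (k, \<eta>))" for P
    by (auto simp flip: simplex_epis_iff)
  then show ?thesis by (auto simp: EM_def Dold_Kan_def PiE_iff)
qed

lemma EM_entry:
  "\<lbrakk>a \<in> carrier (Ob (EM B n) m); \<eta> \<in> epis m k\<rbrakk> \<Longrightarrow> a (k, \<eta>) \<in> carrier (Ch (concentrated B n) k)"
  by (simp add: carrier_EM)

lemma group_EM: "group (Ob (EM B n) m)"
  using comm_group_Ch by (auto simp: EM_def Dold_Kan_def comm_group_def intro!: product_group)

lemma mult_EM: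
  "\<eta> \<in> epis m n \<Longrightarrow> (a \<otimes>\<^bsub>Ob (EM B n) m\<^esub> b) (n, \<eta>) = a (n, \<eta>) \<otimes>\<^bsub>B\<^esub> b (n, \<eta>)"
  by (simp add: EM_def Dold_Kan_def simplex_epis_iff) (simp add: concentrated_def)

lemma EM_component: "\<lbrakk>a \<in> carrier (Ob (EM B n) m); \<eta> \<in> epis m n\<rbrakk> \<Longrightarrow> a (n, \<eta>) \<in> carrier B"
  using EM_entry[of a m \<eta> n] by (simp add: concentrated_def)

lemma EM_eq_oneI:
  assumes a: "a \<in> carrier (Ob (EM B n) m)" and one: "\<And>\<eta>. \<eta> \<in> epis m n \<Longrightarrow> a (n, \<eta>) = \<one>\<^bsub>B\<^esub>"
  shows "a = \<one>\<^bsub>Ob (EM B n) m\<^esub>"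
proof (rule extensionalityI)
  show "a \<in> extensional (simplex_epis m)" using a by (simp add: carrier_EM)
  show "\<one>\<^bsub>Ob (EM B n) m\<^esub> \<in> extensional (simplex_epis m)" by (simp add: EM_def Dold_Kan_def)
  fix i assume i: "i \<in> simplex_epis m"
  then obtain k \<eta> where k: "i = (k, \<eta>)" "\<eta> \<in> epis m k" by (cases i) (auto simp: simplex_epis_iff)
  then have "a (k, \<eta>) = \<one>\<^bsub>B\<^esub>"
    using EM_entry[OF a k(2)] one by (cases "k = n") (auto simp: concentrated_def)
  then show "a i = \<one>\<^bsub>Ob (EM B n) m\<^esub> i" using i k(1) by (simp add: EM_def Dold_Kan_def) (simp add: concentrated_def)
qed

lemma Act_EM_closed:
  assumes a: "a \<in> carrier (Ob (EM B n) m)"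
  shows "Act (EM B n) p m \<theta> a \<in> carrier (Ob (EM B n) p)"
proof -
  have "finprod (Ch (concentrated B n) q) (\<lambda>(k, \<eta>, \<epsilon>). chain_act (concentrated B n) q k \<epsilon> (a (k, \<eta>)))
        {(k, \<eta>, \<epsilon>). (k, \<eta>) \<in> simplex_epis m \<and> \<epsilon> \<in> simplex_monos q k \<and>
            compose {..p} \<epsilon> \<sigma> = compose {..p} \<eta> \<theta>} \<in> carrier (Ch (concentrated B n) q)" for q \<sigma>
  proof -
    interpret C: comm_group "Ch (concentrated B n) q" by (rule comm_group_Ch)
    have "Bd (concentrated B n) k b = \<one>\<^bsub>Ch (concentrated B n) q\<^esub>" for k b by (simp add: concentrated_def)
    then show ?thesis using a
      by (intro C.finprod_closed) (auto simp: chain_act_def carrier_EM simplex_epis_iff)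
  qed
  then show ?thesis unfolding carrier_EM by (simp add: EM_def Dold_Kan_def simplex_epis_iff)
qed

text \<open>Only the identity injection contributes, so the operators of \<open>K(B, n)\<close> reindex surjections.\<close>

lemma Act_EM:
  assumes a: "a \<in> carrier (Ob (EM B n) m)" and \<sigma>: "\<sigma> \<in> epis p n"
  shows "Act (EM B n) p m \<theta> a (n, \<sigma>) =
    finprod B (\<lambda>\<eta>. a (n, \<eta>)) {\<eta> \<in> epis m n. compose {..p} \<eta> \<theta> = \<sigma>}"
proof -
  interpret B: comm_group B by (rule B)
  let ?id = "\<lambda>i\<in>{..n}. i"
  let ?S = "{\<eta> \<in> epis m n. compose {..p} \<eta> \<theta> = \<sigma>}"
  let ?t = "\<lambda>(k, \<eta>, \<epsilon>). chain_act (concentrated B n) n k \<epsilon> (a (k, \<eta>))"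
  define I where "I = {(k, \<eta>, \<epsilon>). (k, \<eta>) \<in> simplex_epis m \<and> \<epsilon> \<in> simplex_monos n k \<and>
            compose {..p} \<epsilon> \<sigma> = compose {..p} \<eta> \<theta>}"
  have id\<sigma>: "compose {..p} ?id \<sigma> = \<sigma>" using simplex_maps_compose_id(2) \<sigma> by (auto simp: epis_def)
  have finI: "finite I"
    by (rule finite_subset[of _ "SIGMA k:{..m}. simplex_maps m k \<times> simplex_maps n k"])
      (auto simp: I_def simplex_epis_def simplex_monos_def finite_simplex_maps)
  have sub: "(\<lambda>\<eta>. (n, \<eta>, ?id)) ` ?S \<subseteq> I"
    using id\<sigma> by (auto simp: I_def simplex_epis_iff simplex_monos_self)
  have other: "?t i = \<one>\<^bsub>B\<^esub>" if "i \<in> I - (\<lambda>\<eta>. (n, \<eta>, ?id)) ` ?S" for i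
  proof -
    obtain k \<eta> \<epsilon> where i: "i = (k, \<eta>, \<epsilon>)" by (cases i)
    have "k \<noteq> n" using that id\<sigma> by (auto simp: i I_def simplex_epis_iff simplex_monos_self)
    then show ?thesis by (simp add: i chain_act_def) (simp add: concentrated_def)
  qed
  have "?t i \<in> carrier B" if "i \<in> I" for i
  proof (cases "i \<in> (\<lambda>\<eta>. (n, \<eta>, ?id)) ` ?S")
    case True
    then show ?thesis using EM_component[OF a] by (auto simp: chain_act_def)
  next
    case False
    then show ?thesis using other[of i] that by simp
  qed
  then have c: "?t \<in> I \<rightarrow> carrier B" by blast
  have "Act (EM B n) p m \<theta> a (n, \<sigma>) = finprod (Ch (concentrated B n) n) ?t I"
    using \<sigma> by (simp add: EM_def Dold_Kan_def simplex_epis_iff I_def)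
  also have "\<dots> = finprod B ?t I" by (simp add: concentrated_def)
  also have "\<dots> = finprod B ?t ((\<lambda>\<eta>. (n, \<eta>, ?id)) ` ?S)"
    by (rule B.finprod_mono_neutral_cong_right[OF finI sub other _ c]) simp_all
  also have "\<dots> = finprod B (\<lambda>\<eta>. ?t (n, \<eta>, ?id)) ?S"
    by (rule B.finprod_reindex) (auto simp: inj_on_def chain_act_def intro: EM_component[OF a])
  also have "\<dots> = finprod B (\<lambda>\<eta>. a (n, \<eta>)) ?S" by (simp add: chain_act_def)
  finally show ?thesis .
qed

end
section \<open>The Dold--Kan comparison map\<close>

lemma hom_finprod:
  assumes G: "comm_group G" and H: "comm_group H" and h: "h \<in> hom G H" and f: "f \<in> A \<rightarrow> carrier G"
  shows "h (finprod G f A) = finprod H (\<lambda>i. h (f i)) A"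
proof -
  interpret G: comm_group G by fact
  interpret H: comm_group H by fact
  interpret group_hom G H h by (intro group_hom.intro group_hom_axioms.intro G.group_axioms H.group_axioms h)
  show ?thesis using f
  proof (induct A rule: infinite_finite_induct)
    case (insert a A)
    then have "f a \<in> carrier G" "f \<in> A \<rightarrow> carrier G" by auto
    moreover from this have "(\<lambda>i. h (f i)) \<in> A \<rightarrow> carrier H" by (auto simp: Pi_iff)
    ultimately show ?case using insert by simp
  qed simp_all
qed

text \<open>
  The Dold--Kan decomposition: level \<open>m\<close> of \<open>X\<close> is the product of the copies of \<open>X\<^sub>n\<close> that the
  degeneracies along the surjections \<open>[m] \<rightarrow> [n]\<close> embed into it.
\<close>

locale concentrated_sgrp_iso = concentrated_sgrp X n for X :: "'a sgrp" and n :: nat +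
  fixes B :: "'b monoid" and \<phi> :: "'b \<Rightarrow> 'a"
  assumes B: "comm_group B" and \<phi>: "\<phi> \<in> iso B (Ob X n)"
begin

definition dk :: "nat \<Rightarrow> (nat \<times> (nat \<Rightarrow> nat) \<Rightarrow> 'b) \<Rightarrow> 'a" where
  "dk m a = finprod (Ob X m) (\<lambda>\<eta>. Act X m n \<eta> (\<phi> (a (n, \<eta>)))) (epis m n)"

lemma \<phi>_hom: "\<phi> \<in> hom B (Ob X n)" and \<phi>_bij: "bij_betw \<phi> (carrier B) (carrier (Ob X n))"
  using \<phi> by (auto simp: iso_def)

lemma \<phi>_group_hom: "group_hom B (Ob X n) \<phi>"
  using B \<phi>_hom sgrp_group[OF X] by (auto simp: comm_group_def intro!: group_hom.intro group_hom_axioms.intro)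

lemma \<phi>_closed: "b \<in> carrier B \<Longrightarrow> \<phi> b \<in> carrier (Ob X n)"
  using \<phi>_hom by (auto simp: hom_def)

lemma epis_maps: "\<eta> \<in> epis m k \<Longrightarrow> \<eta> \<in> simplex_maps m k"
  by (simp add: epis_def)

lemma summand_closed:
  "\<lbrakk>a \<in> carrier (Ob (EM B n) m); \<eta> \<in> epis m n; \<theta> \<in> simplex_maps p n\<rbrakk>
    \<Longrightarrow> Act X p n \<theta> (\<phi> (a (n, \<eta>))) \<in> carrier (Ob X p)"
  by (rule simplicial_groupD(3)[OF X]) (simp_all add: \<phi>_closed EM_component[OF B])

lemma dk_hom: "dk m \<in> hom (Ob (EM B n) m) (Ob X m)"
proof (rule homI)
  interpret C: comm_group "Ob X m" by (rule comm_levels)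
  fix a assume a: "a \<in> carrier (Ob (EM B n) m)"
  show "dk m a \<in> carrier (Ob X m)"
    unfolding dk_def by (rule C.finprod_closed) (auto intro: summand_closed[OF a] epis_maps)
  fix b assume b: "b \<in> carrier (Ob (EM B n) m)"
  interpret f: group_hom B "Ob X n" \<phi> by (rule \<phi>_group_hom)
  have "Act X m n \<eta> (\<phi> ((a \<otimes>\<^bsub>Ob (EM B n) m\<^esub> b) (n, \<eta>))) =
      Act X m n \<eta> (\<phi> (a (n, \<eta>))) \<otimes>\<^bsub>Ob X m\<^esub> Act X m n \<eta> (\<phi> (b (n, \<eta>)))" if \<eta>: "\<eta> \<in> epis m n" for \<eta>
    using EM_component[OF B a \<eta>] EM_component[OF B b \<eta>]
    by (simp add: mult_EM[OF B \<eta>] group_hom.hom_mult[OF Act_group_hom[OF X epis_maps[OF \<eta>]]])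
  then have "dk m (a \<otimes>\<^bsub>Ob (EM B n) m\<^esub> b) = finprod (Ob X m)
      (\<lambda>\<eta>. Act X m n \<eta> (\<phi> (a (n, \<eta>))) \<otimes>\<^bsub>Ob X m\<^esub> Act X m n \<eta> (\<phi> (b (n, \<eta>)))) (epis m n)"
    unfolding dk_def
    by (intro C.finprod_cong') (auto intro!: C.m_closed summand_closed[OF a] summand_closed[OF b] epis_maps)
  also have "\<dots> = dk m a \<otimes>\<^bsub>Ob X m\<^esub> dk m b"
    unfolding dk_def
    by (rule C.finprod_multf) (auto intro: summand_closed[OF a] summand_closed[OF b] epis_maps)
  finally show "dk m (a \<otimes>\<^bsub>Ob (EM B n) m\<^esub> b) = dk m a \<otimes>\<^bsub>Ob X m\<^esub> dk m b" .
qed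

lemma dk_group_hom: "group_hom (Ob (EM B n) m) (Ob X m) (dk m)"
  by (intro group_hom.intro group_hom_axioms.intro group_EM[OF B] sgrp_group[OF X] dk_hom)

lemma Act_dk:
  assumes a: "a \<in> carrier (Ob (EM B n) m)" and \<theta>: "\<theta> \<in> simplex_maps p m"
  shows "Act X p m \<theta> (dk m a) =
    finprod (Ob X p) (\<lambda>\<eta>. Act X p n (compose {..p} \<eta> \<theta>) (\<phi> (a (n, \<eta>)))) (epis m n)"
proof -
  interpret C: comm_group "Ob X p" by (rule comm_levels)
  have "Act X p m \<theta> (dk m a) = finprod (Ob X p) (\<lambda>\<eta>. Act X p m \<theta> (Act X m n \<eta> (\<phi> (a (n, \<eta>))))) (epis m n)"
    unfolding dk_def
    by (rule hom_finprod[OF comm_levels comm_levels simplicial_groupD(2)[OF X \<theta>]])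
      (auto intro: summand_closed[OF a] epis_maps)
  also have "\<dots> = finprod (Ob X p) (\<lambda>\<eta>. Act X p n (compose {..p} \<eta> \<theta>) (\<phi> (a (n, \<eta>)))) (epis m n)"
  proof (rule C.finprod_cong')
    show "(\<lambda>\<eta>. Act X p n (compose {..p} \<eta> \<theta>) (\<phi> (a (n, \<eta>)))) \<in> epis m n \<rightarrow> carrier (Ob X p)"
      by (intro Pi_I summand_closed[OF a] simplex_maps_compose[OF \<theta>] epis_maps)
    show "Act X p m \<theta> (Act X m n \<eta> (\<phi> (a (n, \<eta>)))) = Act X p n (compose {..p} \<eta> \<theta>) (\<phi> (a (n, \<eta>)))"
      if "\<eta> \<in> epis m n" for \<eta>
      using simplicial_groupD(5)[OF X \<theta> epis_maps[OF that] \<phi>_closed[OF EM_component[OF B a that]]] by simp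
  qed simp
  finally show ?thesis .
qed

text \<open>
  The factors are grouped by the composite \<open>\<eta> \<circ> \<theta>\<close>. The fibre over a surjection \<open>\<sigma>\<close> multiplies up to the
  entry at \<open>\<sigma>\<close> of the operator of \<open>K(B, n)\<close>; a composite that is not surjective passes through a face of
  \<open>X\<^sub>n\<close>, and all these faces are trivial.
\<close>

lemma dk_natural:
  assumes a: "a \<in> carrier (Ob (EM B n) m)" and \<theta>: "\<theta> \<in> simplex_maps p m"
  shows "Act X p m \<theta> (dk m a) = dk p (Act (EM B n) p m \<theta> a)"
proof -
  interpret C: comm_group "Ob X p" by (rule comm_levels)
  interpret B: comm_group B by (rule B)
  let ?t = "\<lambda>\<eta>. Act X p n (compose {..p} \<eta> \<theta>) (\<phi> (a (n, \<eta>)))"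
  let ?fib = "\<lambda>\<sigma>. {\<eta> \<in> epis m n. compose {..p} \<eta> \<theta> = \<sigma>}"
  have t: "?t \<eta> \<in> carrier (Ob X p)" if "\<eta> \<in> epis m n" for \<eta>
    by (rule summand_closed[OF a that simplex_maps_compose[OF \<theta> epis_maps[OF that]]])
  have other: "?t \<eta> = \<one>\<^bsub>Ob X p\<^esub>" if "\<eta> \<in> epis m n - \<Union>(?fib ` epis p n)" for \<eta>
  proof (rule Act_non_surj)
    show c: "compose {..p} \<eta> \<theta> \<in> simplex_maps p n"
      using that by (intro simplex_maps_compose[OF \<theta>] epis_maps) auto
    show "compose {..p} \<eta> \<theta> ` {..p} \<noteq> {..n}" using that c by (auto simp: epis_def)
    show "\<phi> (a (n, \<eta>)) \<in> carrier (Ob X n)" using that by (intro \<phi>_closed EM_component[OF B a]) auto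
  qed
  have fib: "finprod (Ob X p) ?t (?fib \<sigma>) = Act X p n \<sigma> (\<phi> (Act (EM B n) p m \<theta> a (n, \<sigma>)))"
    if \<sigma>: "\<sigma> \<in> epis p n" for \<sigma>
  proof -
    have h: "(\<lambda>b. Act X p n \<sigma> (\<phi> b)) \<in> hom B (Ob X p)"
      using hom_compose[OF \<phi>_hom simplicial_groupD(2)[OF X epis_maps[OF \<sigma>]]] by (simp add: comp_def)
    have "Act X p n \<sigma> (\<phi> (Act (EM B n) p m \<theta> a (n, \<sigma>))) =
        finprod (Ob X p) (\<lambda>\<eta>. Act X p n \<sigma> (\<phi> (a (n, \<eta>)))) (?fib \<sigma>)"
      unfolding Act_EM[OF B a \<sigma>]
      by (rule hom_finprod[OF B comm_levels h]) (auto intro: EM_component[OF B a])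
    also have "\<dots> = finprod (Ob X p) ?t (?fib \<sigma>)"
      by (rule C.finprod_cong') (auto intro: t)
    finally show ?thesis by simp
  qed
  have "Act X p m \<theta> (dk m a) = finprod (Ob X p) ?t (epis m n)"
    by (rule Act_dk[OF a \<theta>])
  also have "\<dots> = finprod (Ob X p) ?t (\<Union>(?fib ` epis p n))"
    by (rule C.finprod_mono_neutral_cong_right[OF finite_epis _ other]) (auto intro: t)
  also have "\<dots> = finprod (Ob X p) (\<lambda>\<sigma>. finprod (Ob X p) ?t (?fib \<sigma>)) (epis p n)"
    by (rule C.finprod_UN_disjoint)
      (auto simp: finite_epis pairwise_def disjnt_def intro: t)
  also have "\<dots> = dk p (Act (EM B n) p m \<theta> a)"
    unfolding dk_def
    by (rule C.finprod_cong')
      (auto simp: fib intro!: summand_closed[OF Act_EM_closed[OF B a]] epis_maps)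
  finally show ?thesis .
qed

text \<open>
  Triangularity: among the surjections with nontrivial entry a pointwise minimal one is isolated by
  its last section.
\<close>

lemma dk_eq_one:
  assumes a: "a \<in> carrier (Ob (EM B n) m)" and one: "dk m a = \<one>\<^bsub>Ob X m\<^esub>"
  shows "a = \<one>\<^bsub>Ob (EM B n) m\<^esub>"
proof (rule EM_eq_oneI[OF B a], rule ccontr)
  interpret B: comm_group B by (rule B)
  interpret C: comm_group "Ob X n" by (rule comm_levels)
  interpret f: group_hom B "Ob X n" \<phi> by (rule \<phi>_group_hom)
  fix \<eta>0 assume "\<eta>0 \<in> epis m n" "a (n, \<eta>0) \<noteq> \<one>\<^bsub>B\<^esub>"
  then obtain \<eta> where \<eta>: "\<eta> \<in> epis m n" "a (n, \<eta>) \<noteq> \<one>\<^bsub>B\<^esub>"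
    \<comment> \<open>The sum of the values is a numerical measure for the pointwise order.\<close>
    and least: "\<And>\<eta>'. \<lbrakk>\<eta>' \<in> epis m n; a (n, \<eta>') \<noteq> \<one>\<^bsub>B\<^esub>\<rbrakk> \<Longrightarrow> sum \<eta> {..m} \<le> sum \<eta>' {..m}"
    using ex_has_least_nat[of "\<lambda>\<eta>. \<eta> \<in> epis m n \<and> a (n, \<eta>) \<noteq> \<one>\<^bsub>B\<^esub>" \<eta>0 "\<lambda>\<eta>. sum \<eta> {..m}"] by blast
  from \<eta>(1) obtain \<delta> where \<delta>: "\<delta> \<in> simplex_maps n m" "compose {..n} \<eta> \<delta> = (\<lambda>i\<in>{..n}. i)"
    and below: "\<And>\<eta>' i. \<lbrakk>\<eta>' \<in> simplex_maps m n; compose {..n} \<eta>' \<delta> = (\<lambda>i\<in>{..n}. i); i \<le> m\<rbrakk> \<Longrightarrow> \<eta>' i \<le> \<eta> i"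
    by (auto simp: epis_def elim: last_section)
  have c: "\<phi> (a (n, \<eta>')) \<in> carrier (Ob X n)" if "\<eta>' \<in> epis m n" for \<eta>'
    using that by (intro \<phi>_closed EM_component[OF B a])
  \<comment> \<open>Surjections that are strictly below \<open>\<eta>\<close> carry a trivial entry by minimality, and all others except
    \<open>\<eta>\<close> itself do not have \<open>\<delta>\<close> as a section.\<close>
  have "Act X n n (compose {..n} \<eta>' \<delta>) (\<phi> (a (n, \<eta>'))) = (if \<eta>' = \<eta> then \<phi> (a (n, \<eta>')) else \<one>\<^bsub>Ob X n\<^esub>)"
    if \<eta>': "\<eta>' \<in> epis m n" for \<eta>'
  proof (cases "compose {..n} \<eta>' \<delta> = (\<lambda>i\<in>{..n}. i)")
    case id: True
    show ?thesis
    proof (cases "\<eta>' = \<eta>")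
      case False
      then obtain i where "i \<le> m" "\<eta>' i \<noteq> \<eta> i"
        using simplex_maps_eqI[OF epis_maps[OF \<eta>'] epis_maps[OF \<eta>(1)]] by blast
      then have "sum \<eta>' {..m} < sum \<eta> {..m}"
        using below[OF epis_maps[OF \<eta>'] id] by (intro sum_strict_mono_ex1) (auto simp: order.strict_iff_order)
      then have "a (n, \<eta>') = \<one>\<^bsub>B\<^esub>" using least[OF \<eta>'] by force
      then show ?thesis using False id simplicial_groupD(4)[OF X] by simp
    qed (use id simplicial_groupD(4)[OF X c[OF \<eta>']] in simp)
  next
    case False
    then have "\<eta>' \<noteq> \<eta>" using \<delta>(2) by blast
    moreover have comp: "compose {..n} \<eta>' \<delta> \<in> simplex_maps n n"
      by (rule simplex_maps_compose[OF \<delta>(1) epis_maps[OF \<eta>']])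
    moreover have "compose {..n} \<eta>' \<delta> ` {..n} \<noteq> {..n}" using surj_endo_eq_id[OF comp] False by blast
    ultimately show ?thesis using Act_non_surj c[OF \<eta>'] by simp
  qed
  then have "Act X n m \<delta> (dk m a) =
      finprod (Ob X n) (\<lambda>\<eta>'. if \<eta>' = \<eta> then \<phi> (a (n, \<eta>')) else \<one>\<^bsub>Ob X n\<^esub>) (epis m n)"
    unfolding Act_dk[OF a \<delta>(1)] by (intro C.finprod_cong') (auto intro: c)
  also have "\<dots> = \<phi> (a (n, \<eta>))"
    by (rule C.finprod_singleton_swap[OF \<eta>(1) finite_epis]) (auto intro: c)
  finally have "\<phi> (a (n, \<eta>)) = \<phi> \<one>\<^bsub>B\<^esub>"
    using one group_hom.hom_one[OF Act_group_hom[OF X \<delta>(1)]] by simp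
  then have "a (n, \<eta>) = \<one>\<^bsub>B\<^esub>"
    using inj_onD[OF bij_betw_imp_inj_on[OF \<phi>_bij] _ EM_component[OF B a \<eta>(1)] B.one_closed] by blast
  then show False using \<eta>(2) by blast
qed

lemma dk_surj_level: "carrier (Ob X n) \<subseteq> dk n ` carrier (Ob (EM B n) n)"
proof
  interpret B: comm_group B by (rule B)
  interpret C: comm_group "Ob X n" by (rule comm_levels)
  fix x assume x: "x \<in> carrier (Ob X n)"
  then have "x \<in> \<phi> ` carrier B" using \<phi>_bij by (simp add: bij_betw_def)
  then obtain b where b: "b \<in> carrier B" "\<phi> b = x" by blast
  define a where "a = (\<lambda>(k, \<eta>)\<in>simplex_epis n. if k = n then b else \<one>\<^bsub>B\<^esub>)"
  have "a \<in> carrier (Ob (EM B n) n)"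
    using b by (auto simp: carrier_EM[OF B] a_def simplex_epis_iff concentrated_def)
  moreover have "dk n a = x"
    using b x simplicial_groupD(4)[OF X x]
    by (simp add: dk_def epis_self a_def simplex_epis_iff)
  ultimately show "x \<in> dk n ` carrier (Ob (EM B n) n)" by blast
qed

text \<open>
  The image is closed under the operators, so descent carries surjectivity from one level to the
  next above \<open>n\<close>.
\<close>

lemma dk_surj: "carrier (Ob X m) \<subseteq> dk m ` carrier (Ob (EM B n) m)"
proof (induction m)
  case 0
  interpret d: group_hom "Ob (EM B n) 0" "Ob X 0" "dk 0" by (rule dk_group_hom)
  show ?case using trivial_below[OF pos] subgroup.one_closed[OF d.img_is_subgroup] by simp
next
  case (Suc m)
  show ?case
  proof (cases "Suc m = n")
    case True
    then show ?thesis using dk_surj_level by blast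
  next
    case False
    let ?H = "\<lambda>m. dk m ` carrier (Ob (EM B n) m)"
    have sub: "subgroup (?H m) (Ob X m)" for m by (rule group_hom.img_is_subgroup[OF dk_group_hom])
    have act: "Act X m l \<theta> h \<in> ?H m" if "\<theta> \<in> simplex_maps m l" "h \<in> ?H l" for m l \<theta> h
      using that dk_natural Act_EM_closed[OF B] by auto
    show ?thesis
    proof
      fix x assume x: "x \<in> carrier (Ob X (Suc m))"
      have f: "face X (Suc m) j x \<in> ?H m" if "j \<le> m" for j
        using face_closed[OF X _ x, of j] Suc.IH by auto
      obtain h where h: "h \<in> ?H (Suc m)" "x \<otimes>\<^bsub>Ob X (Suc m)\<^esub> h \<in> carrier (moore X (Suc m))"
        by (rule descent_to_moore[OF X sub act x f])
      have "x \<otimes>\<^bsub>Ob X (Suc m)\<^esub> h = \<one>\<^bsub>Ob X (Suc m)\<^esub>"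
        using h(2) conc[OF False] trivial_moore_iff_subset[OF X] by blast
      then have "x \<otimes>\<^bsub>Ob X (Suc m)\<^esub> h \<in> ?H (Suc m)" using subgroup.one_closed[OF sub] by simp
      moreover have "h \<in> carrier (Ob X (Suc m))" using h(1) subgroup.subset[OF sub] by blast
      ultimately show "x \<in> ?H (Suc m)"
        by (intro group.mult_in_subgroup_imp_left[OF sgrp_group[OF X] sub x _ h(1)])
    qed
  qed
qed

lemma dk_iso: "dk m \<in> iso (Ob (EM B n) m) (Ob X m)"
  using dk_surj dk_eq_one by (auto simp: group_hom.iso_iff[OF dk_group_hom])

theorem isomorphic_EM: "simplicial_isomorphic X (EM B n)"
proof -
  define f where "f = (\<lambda>m. inv_into (carrier (Ob (EM B n) m)) (dk m))"
  have iso: "f m \<in> iso (Ob X m) (Ob (EM B n) m)" for m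
    unfolding f_def by (rule group.iso_set_sym[OF group_EM[OF B] dk_iso])
  have bij: "bij_betw (dk m) (carrier (Ob (EM B n) m)) (carrier (Ob X m))" for m
    using dk_iso[of m] by (simp add: iso_def)
  have "f \<in> simplicial_hom X (EM B n)"
  proof (rule simplicial_homI)
    show "f m \<in> hom (Ob X m) (Ob (EM B n) m)" for m using iso[of m] by (simp add: iso_def)
    fix p m \<theta> x assume \<theta>: "\<theta> \<in> simplex_maps p m" and x: "x \<in> carrier (Ob X m)"
    then obtain a where a: "a \<in> carrier (Ob (EM B n) m)" "x = dk m a" using dk_surj[of m] by blast
    have inv: "f m (dk m a) = a" if "a \<in> carrier (Ob (EM B n) m)" for m a
      using bij[of m] that by (simp add: f_def bij_betw_def)
    show "f p (Act X p m \<theta> x) = Act (EM B n) p m \<theta> (f m x)"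
      using a by (simp add: dk_natural[OF a(1) \<theta>] inv Act_EM_closed[OF B])
  qed
  then show ?thesis using iso by (auto simp: simplicial_isomorphic_def)
qed

end

theorem corollary4p6:
  fixes X :: "'a sgrp" and n :: nat
  shows "(n \<ge> 1 \<and> X \<in> trivial_objects (pretorsion_pair (mu_upto n) (mu_from n)) \<longrightarrow>
            comm_group (homotopy_group X n) \<and>
            simplicial_isomorphic X (EM (homotopy_group X n) n)) \<and>
         (X \<in> trivial_objects (pretorsion_pair (mu_from (n + 1)) (mu_upto n)) \<longrightarrow>
            (\<forall>k. trivial_group (homotopy_group X k)))"
proof (intro conjI[of "_ \<longrightarrow> _"] impI allI)
  assume "n \<ge> 1 \<and> X \<in> trivial_objects (pretorsion_pair (mu_upto n) (mu_from n))"
  then have n: "n \<ge> 1" and X: "X \<in> M_from n" "X \<in> M_upto n"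
    by (auto simp: trivial_objects_def pretorsion_pair_def mu_upto_def mu_from_def)
  interpret concentrated_sgrp X n
  proof (rule concentrated_sgrp.intro)
    show "simplicial_group X" using X(1) by (simp add: M_from_def)
    show "trivial_group (moore X i)" if "i \<noteq> n" for i
      using X that by (cases "i < n") (simp_all add: M_from_def M_upto_def)
  qed (use n in simp)
  interpret C: comm_group "Ob X n" by (rule comm_level)
  have iso: "the_elem \<in> iso (homotopy_group X n) (Ob X n)"
    unfolding homotopy_group_eq by (rule C.trivial_factor_iso)
  have "group (homotopy_group X n)"
    unfolding homotopy_group_eq by (rule normal.factorgroup_is_group[OF C.one_is_normal])
  then have comm: "comm_group (homotopy_group X n)"
    using C.iso_imp_comm_group[OF group.iso_sym[OF _ is_isoI[OF iso]]] by (simp add: group.is_monoid)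
  interpret concentrated_sgrp_iso X n "homotopy_group X n" the_elem
    by (intro concentrated_sgrp_iso.intro concentrated_sgrp_iso_axioms.intro concentrated_sgrp_axioms comm iso)
  show "comm_group (homotopy_group X n) \<and> simplicial_isomorphic X (EM (homotopy_group X n) n)"
    using comm isomorphic_EM by simp
next
  fix k
  assume "X \<in> trivial_objects (pretorsion_pair (mu_from (n + 1)) (mu_upto n))"
  then have "X \<in> Ker_Cot n" "X \<in> F_tr n"
    by (auto simp: trivial_objects_def pretorsion_pair_def mu_upto_def mu_from_def)
  then show "trivial_group (homotopy_group X k)" by (rule Ker_Cot_F_tr_aspherical)
qed

end
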